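(* Let $R_1 \to R_{12}$ and $R_2 \to R_{12}$ be flat homomorphisms of commutative rings such that the multiplication map $R_{12}\otimes_{R_2}R_{12}\to R_{12}$ is bijective. Then every object $(M_1,M_2,\varphi)$ of $\mathrm{Mod}(R_1) \times_{\mathrm{Mod}(R_{12})} \mathrm{Mod}(R_2)$ such that $M_1$ is a finitely generated $R_1$-module and $M_2$ is a finitely generated $R_2$-module is the quotient of a triple $(R_1^{\oplus n}, R_2^{\oplus n}, A)$ for a suitable integer $n\geq 0$ and a suitable $A\in \mathrm{GL}_n(R_{12})$.
   Context: For ring homomorphisms $R_1\to R_{12}\leftarrow R_2$, the 2-fiber product $\mathrm{Mod}(R_1) \times_{\mathrm{Mod}(R_{12})} \mathrm{Mod}(R_2)$ is the category whose objects are triples $(M_1,M_2,\varphi)$, where $M_i$ is an $R_i$-module ($i=1,2$) and $\varphi: M_1\otimes_{R_1} R_{12}\to M_2\otimes_{R_2} R_{12}$ is an isomorphism of $R_{12}$-modules. A morphism $(M_1,M_2,\varphi)\to (N_1,N_2,\psi)$ is a pair $(f_1,f_2)$ of $R_i$-linear maps $f_i:M_i\to N_i$ with $\psi\circ (f_1\otimes\mathrm{id}) = (f_2\otimes\mathrm{id})\circ\varphi$. In $(R_1^{\oplus n}, R_2^{\oplus n}, A)$ the matrix $A$ is viewed as an automorphism of $R_{12}^{\oplus n}=R_i^{\oplus n}\otimes_{R_i}R_{12}$. "Quotient" means that there is a morphism of triples $(f_1,f_2)$ onto $(M_1,M_2,\varphi)$ with both $f_1$ and $f_2$ surjective. *)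

theory Defs
  imports "HOL-Algebra.Module" "HOL-Algebra.AbelCoset" "HOL-Algebra.Free_Abelian_Groups"
begin

section \<open>Linear maps, generation, free modules\<close>

definition mod_homs ::
  "('a,'r) ring_scheme \<Rightarrow> ('a,'m,'p) module_scheme \<Rightarrow> ('a,'n,'q) module_scheme \<Rightarrow> ('m \<Rightarrow> 'n) set"
  where "mod_homs R M N =
    {f \<in> carrier M \<rightarrow> carrier N.
       (\<forall>x\<in>carrier M. \<forall>y\<in>carrier M. f (x \<oplus>\<^bsub>M\<^esub> y) = f x \<oplus>\<^bsub>N\<^esub> f y) \<and>
       (\<forall>r\<in>carrier R. \<forall>x\<in>carrier M. f (r \<odot>\<^bsub>M\<^esub> x) = r \<odot>\<^bsub>N\<^esub> f x)}"

definition mod_isos ::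
  "('a,'r) ring_scheme \<Rightarrow> ('a,'m,'p) module_scheme \<Rightarrow> ('a,'n,'q) module_scheme \<Rightarrow> ('m \<Rightarrow> 'n) set"
  where "mod_isos R M N = {f \<in> mod_homs R M N. bij_betw f (carrier M) (carrier N)}"

definition fin_gen_module :: "('a,'r) ring_scheme \<Rightarrow> ('a,'m,'p) module_scheme \<Rightarrow> bool"
  where "fin_gen_module R M \<longleftrightarrow>
    (\<exists>A. finite A \<and> A \<subseteq> carrier M \<and>
      (\<forall>x\<in>carrier M. \<exists>c \<in> A \<rightarrow> carrier R. x = (\<Oplus>\<^bsub>M\<^esub>a\<in>A. c a \<odot>\<^bsub>M\<^esub> a)))"

text \<open>The record type of modules extends that of rings. Its multiplicative fields \<open>mult\<close> and
  \<open>one\<close> play no role for a module and are left \<open>undefined\<close> in the constructions below.\<close>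

definition free_module :: "('a,'r) ring_scheme \<Rightarrow> nat \<Rightarrow> ('a, nat \<Rightarrow> 'a) module"
  where "free_module R n =
    \<lparr>carrier = {..<n} \<rightarrow>\<^sub>E carrier R, monoid.mult = undefined, one = undefined,
     ring.zero = (\<lambda>i\<in>{..<n}. \<zero>\<^bsub>R\<^esub>), ring.add = (\<lambda>v w. \<lambda>i\<in>{..<n}. v i \<oplus>\<^bsub>R\<^esub> w i),
     smult = (\<lambda>r v. \<lambda>i\<in>{..<n}. r \<otimes>\<^bsub>R\<^esub> v i)\<rparr>"

definition mat_monoid :: "('a,'r) ring_scheme \<Rightarrow> nat \<Rightarrow> (nat \<times> nat \<Rightarrow> 'a) monoid"
  where "mat_monoid R n =
    \<lparr>carrier = {..<n} \<times> {..<n} \<rightarrow>\<^sub>E carrier R,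
     monoid.mult = (\<lambda>A B. \<lambda>(i,j)\<in>{..<n} \<times> {..<n}. \<Oplus>\<^bsub>R\<^esub>k\<in>{..<n}. A (i,k) \<otimes>\<^bsub>R\<^esub> B (k,j)),
     one = (\<lambda>(i,j)\<in>{..<n} \<times> {..<n}. if i = j then \<one>\<^bsub>R\<^esub> else \<zero>\<^bsub>R\<^esub>)\<rparr>"

definition GL :: "nat \<Rightarrow> ('a,'r) ring_scheme \<Rightarrow> (nat \<times> nat \<Rightarrow> 'a) set"
  where "GL n R = Units (mat_monoid R n)"

definition mat_vec ::
  "('a,'r) ring_scheme \<Rightarrow> nat \<Rightarrow> (nat \<times> nat \<Rightarrow> 'a) \<Rightarrow> (nat \<Rightarrow> 'a) \<Rightarrow> nat \<Rightarrow> 'a"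
  where "mat_vec R n A v = (\<lambda>i\<in>{..<n}. \<Oplus>\<^bsub>R\<^esub>j\<in>{..<n}. A (i,j) \<otimes>\<^bsub>R\<^esub> v j)"


section \<open>Tensor products\<close>

text \<open>\<open>M \<otimes>\<^sub>R N\<close> is the free abelian group on \<open>M \<times> N\<close> modulo the subgroup generated by the
  bilinearity relations; its elements are cosets.\<close>

type_synonym ('m,'n) tensor = "(('m \<times> 'n) \<Rightarrow>\<^sub>0 int) set"

definition tensor_rels ::
  "('a,'r) ring_scheme \<Rightarrow> ('a,'m,'p) module_scheme \<Rightarrow> ('a,'n,'q) module_scheme
    \<Rightarrow> (('m \<times> 'n) \<Rightarrow>\<^sub>0 int) set"
  where "tensor_rels R M N =
    {frag_of (x \<oplus>\<^bsub>M\<^esub> x', y) - frag_of (x, y) - frag_of (x', y) | x x' y.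
       x \<in> carrier M \<and> x' \<in> carrier M \<and> y \<in> carrier N} \<union>
    {frag_of (x, y \<oplus>\<^bsub>N\<^esub> y') - frag_of (x, y) - frag_of (x, y') | x y y'.
       x \<in> carrier M \<and> y \<in> carrier N \<and> y' \<in> carrier N} \<union>
    {frag_of (r \<odot>\<^bsub>M\<^esub> x, y) - frag_of (x, r \<odot>\<^bsub>N\<^esub> y) | r x y.
       r \<in> carrier R \<and> x \<in> carrier M \<and> y \<in> carrier N}"

definition tensor_grp ::
  "('a,'r) ring_scheme \<Rightarrow> ('a,'m,'p) module_scheme \<Rightarrow> ('a,'n,'q) module_scheme
    \<Rightarrow> ('m,'n) tensor ring"
  where "tensor_grp R M N =
    (let F = free_Abelian_group (carrier M \<times> carrier N); G = F Mod (generate F (tensor_rels R M N))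
     in \<lparr>carrier = carrier G, monoid.mult = undefined, one = undefined,
         ring.zero = one G, ring.add = monoid.mult G\<rparr>)"

text \<open>\<open>M \<otimes>\<^sub>R N\<close> with a prescribed operation of scalars.\<close>

definition tensor_with_smult ::
  "('a,'r) ring_scheme \<Rightarrow> ('a,'m,'p) module_scheme \<Rightarrow> ('a,'n,'q) module_scheme
    \<Rightarrow> ('s \<Rightarrow> ('m,'n) tensor \<Rightarrow> ('m,'n) tensor) \<Rightarrow> ('s, ('m,'n) tensor) module"
  where "tensor_with_smult R M N sm =
    \<lparr>carrier = carrier (tensor_grp R M N), monoid.mult = undefined, one = undefined,
     ring.zero = ring.zero (tensor_grp R M N), ring.add = ring.add (tensor_grp R M N),
     smult = sm\<rparr>"

definition pure_tensor ::
  "('a,'r) ring_scheme \<Rightarrow> ('a,'m,'p) module_scheme \<Rightarrow> ('a,'n,'q) module_scheme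
    \<Rightarrow> 'm \<Rightarrow> 'n \<Rightarrow> ('m,'n) tensor"
  where "pure_tensor R M N x y =
    (let F = free_Abelian_group (carrier M \<times> carrier N)
     in generate F (tensor_rels R M N) #>\<^bsub>F\<^esub> frag_of (x, y))"

text \<open>\<open>tensor_lift P \<beta>\<close> is the additive map from \<open>M \<otimes>\<^sub>R N\<close> to \<open>P\<close> with \<open>x \<otimes> y \<mapsto> \<beta> x y\<close>. If \<open>\<beta>\<close> is
  additive in both variables and \<open>R\<close>-balanced, then the extension of \<open>\<beta>\<close> to the free abelian group
  is constant on every coset, so the image of a coset is a singleton.\<close>

definition tensor_lift ::
  "('p,'q) ring_scheme \<Rightarrow> ('m \<Rightarrow> 'n \<Rightarrow> 'p) \<Rightarrow> ('m,'n) tensor \<Rightarrow> 'p"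
  where "tensor_lift P \<beta> X =
    the_elem ((\<lambda>c. \<Oplus>\<^bsub>P\<^esub>k\<in>Poly_Mapping.keys c.
        [Poly_Mapping.lookup c k] \<cdot>\<^bsub>P\<^esub> case_prod \<beta> k) ` X)"

definition tensor_module ::
  "('a,'r) ring_scheme \<Rightarrow> ('a,'m,'p) module_scheme \<Rightarrow> ('a,'n,'q) module_scheme
    \<Rightarrow> ('a, ('m,'n) tensor) module"
  where "tensor_module R M N =
    tensor_with_smult R M N
      (\<lambda>r. tensor_lift (tensor_grp R M N)
             (\<lambda>x y. pure_tensor R M N (r \<odot>\<^bsub>M\<^esub> x) y))"

text \<open>\<open>f \<otimes> id\<close> for \<open>f : M \<rightarrow> M'\<close> and the module \<open>N\<close>.\<close>

definition tensor_map_id ::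
  "('a,'r) ring_scheme \<Rightarrow> ('a,'m1,'p) module_scheme \<Rightarrow> ('a,'n,'q) module_scheme
    \<Rightarrow> ('m \<Rightarrow> 'm1) \<Rightarrow> ('m,'n) tensor \<Rightarrow> ('m1,'n) tensor"
  where "tensor_map_id R M' N f =
    tensor_lift (tensor_grp R M' N) (\<lambda>x y. pure_tensor R M' N (f x) y)"


section \<open>Scalar extension and flatness\<close>

text \<open>The ring \<open>S\<close> as a module over the domain of a ring homomorphism \<open>h\<close> into \<open>S\<close>.\<close>

definition ring_as_module :: "('s,'t) ring_scheme \<Rightarrow> ('a \<Rightarrow> 's) \<Rightarrow> ('a,'s) module"
  where "ring_as_module S h =
    \<lparr>carrier = carrier S, monoid.mult = monoid.mult S, one = one S,
     ring.zero = ring.zero S, ring.add = ring.add S,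
     smult = (\<lambda>r s. h r \<otimes>\<^bsub>S\<^esub> s)\<rparr>"

text \<open>The \<open>S\<close>-module \<open>M \<otimes>\<^sub>R S\<close>, with \<open>s \<odot> (x \<otimes> t) = x \<otimes> s t\<close>.\<close>

definition base_change ::
  "('a,'r) ring_scheme \<Rightarrow> ('a \<Rightarrow> 's) \<Rightarrow> ('s,'t) ring_scheme \<Rightarrow> ('a,'m,'p) module_scheme
    \<Rightarrow> ('s, ('m,'s) tensor) module"
  where "base_change R h S M =
    tensor_with_smult R M (ring_as_module S h)
      (\<lambda>s. tensor_lift (tensor_grp R M (ring_as_module S h))
             (\<lambda>x t. pure_tensor R M (ring_as_module S h) x (s \<otimes>\<^bsub>S\<^esub> t)))"

abbreviation base_change_map ::
  "('a,'r) ring_scheme \<Rightarrow> ('a \<Rightarrow> 's) \<Rightarrow> ('s,'t) ring_scheme \<Rightarrow> ('a,'m1,'p) module_scheme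
    \<Rightarrow> ('m \<Rightarrow> 'm1) \<Rightarrow> ('m,'s) tensor \<Rightarrow> ('m1,'s) tensor"
  where "base_change_map R h S M' f \<equiv> tensor_map_id R M' (ring_as_module S h) f"

text \<open>Tensoring with \<open>N\<close> preserves exactness of \<open>P \<rightarrow> Q \<rightarrow> T\<close>. A definition cannot quantify over
  types, so \<open>P\<close>, \<open>Q\<close>, \<open>T\<close> range over the modules carried by the type \<open>'a\<close> of the ring elements. This
  is no loss: these include \<open>0 \<rightarrow> I \<rightarrow> R\<close> for every ideal \<open>I\<close> of \<open>R\<close>, and \<open>N\<close> is flat as soon as
  all \<open>I \<otimes>\<^sub>R N \<rightarrow> R \<otimes>\<^sub>R N\<close> are injective.\<close>

definition flat_module :: "('a,'r) ring_scheme \<Rightarrow> ('a,'n,'q) module_scheme \<Rightarrow> bool"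
  where "flat_module R N \<longleftrightarrow>
    module R N \<and>
    (\<forall>(P :: ('a,'a) module) (Q :: ('a,'a) module) (T :: ('a,'a) module) f g.
       module R P \<and> module R Q \<and> module R T \<and> f \<in> mod_homs R P Q \<and> g \<in> mod_homs R Q T \<and>
       f ` carrier P = a_kernel Q T g \<longrightarrow>
       tensor_map_id R Q N f ` carrier (tensor_module R P N) =
         a_kernel (tensor_module R Q N) (tensor_module R T N) (tensor_map_id R T N g))"

text \<open>The multiplication map of \<open>S\<close> on \<open>S \<otimes>\<^sub>R S\<close>.\<close>

definition tensor_mult :: "('s,'t) ring_scheme \<Rightarrow> ('s,'s) tensor \<Rightarrow> 's"
  where "tensor_mult S = tensor_lift S (\<lambda>s t. s \<otimes>\<^bsub>S\<^esub> t)"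


section \<open>The 2-fiber product of module categories\<close>

definition fiber_obj ::
  "('a,'r) ring_scheme \<Rightarrow> ('a \<Rightarrow> 's) \<Rightarrow> ('b,'u) ring_scheme \<Rightarrow> ('b \<Rightarrow> 's) \<Rightarrow> ('s,'t) ring_scheme
    \<Rightarrow> ('a,'m,'p) module_scheme \<times> ('b,'n,'q) module_scheme \<times> (('m,'s) tensor \<Rightarrow> ('n,'s) tensor)
    \<Rightarrow> bool"
  where "fiber_obj R1 h1 R2 h2 R12 = (\<lambda>(M1, M2, \<phi>).
    module R1 M1 \<and> module R2 M2 \<and>
    \<phi> \<in> mod_isos R12 (base_change R1 h1 R12 M1) (base_change R2 h2 R12 M2))"

definition fiber_homs ::
  "('a,'r) ring_scheme \<Rightarrow> ('a \<Rightarrow> 's) \<Rightarrow> ('b,'u) ring_scheme \<Rightarrow> ('b \<Rightarrow> 's) \<Rightarrow> ('s,'t) ring_scheme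
    \<Rightarrow> ('a,'m,'p) module_scheme \<times> ('b,'n,'q) module_scheme \<times> (('m,'s) tensor \<Rightarrow> ('n,'s) tensor)
    \<Rightarrow> ('a,'m1,'p1) module_scheme \<times> ('b,'n1,'q1) module_scheme
        \<times> (('m1,'s) tensor \<Rightarrow> ('n1,'s) tensor)
    \<Rightarrow> (('m \<Rightarrow> 'm1) \<times> ('n \<Rightarrow> 'n1)) set"
  where "fiber_homs R1 h1 R2 h2 R12 = (\<lambda>(M1, M2, \<phi>) (N1, N2, \<psi>).
    {(f1, f2). f1 \<in> mod_homs R1 M1 N1 \<and> f2 \<in> mod_homs R2 M2 N2 \<and>
      (\<forall>X\<in>carrier (base_change R1 h1 R12 M1).
         \<psi> (base_change_map R1 h1 R12 N1 f1 X) = base_change_map R2 h2 R12 N2 f2 (\<phi> X))})"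

definition fiber_quotient ::
  "('a,'r) ring_scheme \<Rightarrow> ('a \<Rightarrow> 's) \<Rightarrow> ('b,'u) ring_scheme \<Rightarrow> ('b \<Rightarrow> 's) \<Rightarrow> ('s,'t) ring_scheme
    \<Rightarrow> ('a,'m,'p) module_scheme \<times> ('b,'n,'q) module_scheme \<times> (('m,'s) tensor \<Rightarrow> ('n,'s) tensor)
    \<Rightarrow> ('a,'m1,'p1) module_scheme \<times> ('b,'n1,'q1) module_scheme
        \<times> (('m1,'s) tensor \<Rightarrow> ('n1,'s) tensor)
    \<Rightarrow> bool"
  where "fiber_quotient R1 h1 R2 h2 R12 Y X \<longleftrightarrow>
    fiber_obj R1 h1 R2 h2 R12 X \<and> fiber_obj R1 h1 R2 h2 R12 Y \<and>
    (\<exists>(f1, f2) \<in> fiber_homs R1 h1 R2 h2 R12 X Y.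
       f1 ` carrier (fst X) = carrier (fst Y) \<and>
       f2 ` carrier (fst (snd X)) = carrier (fst (snd Y)))"

text \<open>The identification \<open>R\<^sup>n \<otimes>\<^sub>R S \<rightarrow> S\<^sup>n\<close>, with \<open>v \<otimes> s \<mapsto> (h (v i) s)\<^sub>i\<close>.\<close>

definition free_base_change :: "('a \<Rightarrow> 's) \<Rightarrow> ('s,'t) ring_scheme \<Rightarrow> nat
    \<Rightarrow> (nat \<Rightarrow> 'a, 's) tensor \<Rightarrow> nat \<Rightarrow> 's"
  where "free_base_change h S n =
    tensor_lift (free_module S n) (\<lambda>v s. \<lambda>i\<in>{..<n}. h (v i) \<otimes>\<^bsub>S\<^esub> s)"

text \<open>The triple \<open>(R1\<^sup>n, R2\<^sup>n, A)\<close>: the matrix \<open>A\<close> acts on \<open>R12\<^sup>n\<close>, transported along the two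
  identifications \<open>Ri\<^sup>n \<otimes> R12 = R12\<^sup>n\<close>.\<close>

definition free_triple ::
  "('a,'r) ring_scheme \<Rightarrow> ('a \<Rightarrow> 's) \<Rightarrow> ('b,'u) ring_scheme \<Rightarrow> ('b \<Rightarrow> 's) \<Rightarrow> ('s,'t) ring_scheme
    \<Rightarrow> nat \<Rightarrow> (nat \<times> nat \<Rightarrow> 's)
    \<Rightarrow> ('a, nat \<Rightarrow> 'a) module \<times> ('b, nat \<Rightarrow> 'b) module
        \<times> ((nat \<Rightarrow> 'a, 's) tensor \<Rightarrow> (nat \<Rightarrow> 'b, 's) tensor)"
  where "free_triple R1 h1 R2 h2 R12 n A =
    (free_module R1 n, free_module R2 n,
     \<lambda>X. inv_into (carrier (base_change R2 h2 R12 (free_module R2 n))) (free_base_change h2 R12 n)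
           (mat_vec R12 n A (free_base_change h1 R12 n X)))"

end

theory Submission
  imports Defs
begin

text \<open>Choose generators of \<open>M\<^sub>1\<close> and of \<open>M\<^sub>2\<close> and pad both families with zeros to families of the same
  length \<open>n\<close> with complementary supports. In \<open>M\<^sub>2 \<otimes> R\<^sub>1\<^sub>2\<close> they give, the first one by way of \<open>\<phi>\<close>, two
  row vectors \<open>x\<close> and \<open>y\<close> of generators, so \<open>x = y C\<close> and \<open>y = x B\<close> for some matrices. As the supports of \<open>x\<close>
  and \<open>y\<close> are complementary, \<open>B\<close> and \<open>C\<close> can be taken supported in an off-diagonal block, so that \<open>B B = C C = 0\<close>. Then
  \<open>x (1 + B) = x + y = y (1 + C)\<close>, hence \<open>x = y A\<close> for \<open>A = (1 + C) (1 - B) \<in> GL\<^sub>n(R\<^sub>1\<^sub>2)\<close>, and this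
  equation says that the two padded families define a morphism from \<open>(R\<^sub>1\<^sup>n, R\<^sub>2\<^sup>n, A)\<close>.\<close>

section \<open>The universal property of the tensor product\<close>

text \<open>Surjections from free modules onto M1 and M2 are easy to choose separately. The obstacle
  is that, after base change, the two have to be linked by an automorphism, while a matrix
  expressing one generating family through another of the same length need not be invertible. The
  padding supplies the missing room, as in Schanuel's lemma. Let p and q be the surjections onto M2
  \<otimes> R12 given by the unpadded parts of x and y. Then (p, 0), (p, q) and (0, q) start from
  the same free module. Since q factors through p and p through q, one shear carries (p, 0) to (p,
  q), another carries (0, q) to (p, q), and A is made of one shear and the inverse of the other.

  Once both families are known to generate over R12, this is linear algebra over a single ring. The
  rest is control over base change: tensors are cosets, so facts about them are obtained by
  comparing additive maps on pure tensors, and \<open>lin_comb\<close> ties a family of elements to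
  the map out of a free module that it defines.\<close>

text \<open>Weaker than \<open>mod_homs\<close> on purpose: it covers maps between structures over
  different rings, such as s \<mapsto> x \<otimes> s or a coordinate of a vector, and maps on
  \<open>tensor_grp\<close>, which carries no scalars at all.\<close>

definition additive :: "('p,'q) ring_scheme \<Rightarrow> ('s,'t) ring_scheme \<Rightarrow> ('p \<Rightarrow> 's) \<Rightarrow> bool" where
  "additive G P f \<longleftrightarrow> f \<in> carrier G \<rightarrow> carrier P \<and>
     (\<forall>x\<in>carrier G. \<forall>y\<in>carrier G. f (x \<oplus>\<^bsub>G\<^esub> y) = f x \<oplus>\<^bsub>P\<^esub> f y)"

lemma additiveI:
  assumes "\<And>x. x \<in> carrier G \<Longrightarrow> f x \<in> carrier P"
    and "\<And>x y. x \<in> carrier G \<Longrightarrow> y \<in> carrier G \<Longrightarrow> f (x \<oplus>\<^bsub>G\<^esub> y) = f x \<oplus>\<^bsub>P\<^esub> f y"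
  shows "additive G P f"
  using assms by (auto simp: additive_def)

lemma additive_closed: "additive G P f \<Longrightarrow> x \<in> carrier G \<Longrightarrow> f x \<in> carrier P"
  by (auto simp: additive_def)

lemma additive_add:
  "additive G P f \<Longrightarrow> x \<in> carrier G \<Longrightarrow> y \<in> carrier G \<Longrightarrow> f (x \<oplus>\<^bsub>G\<^esub> y) = f x \<oplus>\<^bsub>P\<^esub> f y"
  by (auto simp: additive_def)

lemma additive_comp:
  "additive G P f \<Longrightarrow> additive P Q g \<Longrightarrow> additive G Q (\<lambda>x. g (f x))"
  by (auto simp: additive_def Pi_def)

lemma additive_group_hom:
  assumes "abelian_group G" "abelian_group P" "additive G P f"
  shows "group_hom (add_monoid G) (add_monoid P) f"
  by (intro group_hom.intro group_hom_axioms.intro homI abelian_group.a_group assms)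
     (use assms(3) in \<open>auto simp: additive_def\<close>)

lemma additive_zero:
  assumes "abelian_group G" "abelian_group P" "additive G P f"
  shows "f \<zero>\<^bsub>G\<^esub> = \<zero>\<^bsub>P\<^esub>"
  using group_hom.hom_one[OF additive_group_hom[OF assms]] by simp

lemma additive_minus:
  assumes "abelian_group G" "abelian_group P" "additive G P f" "x \<in> carrier G" "y \<in> carrier G"
  shows "f (x \<ominus>\<^bsub>G\<^esub> y) = f x \<ominus>\<^bsub>P\<^esub> f y"
proof -
  interpret G: abelian_group G by fact
  have "f (\<ominus>\<^bsub>G\<^esub> y) = \<ominus>\<^bsub>P\<^esub> f y"
    using group_hom.hom_inv[OF additive_group_hom[OF assms(1-3)], of y] assms(5)
    by (simp add: a_inv_def)
  then show ?thesis
    using additive_add[OF assms(3), of x "\<ominus>\<^bsub>G\<^esub> y"] assms(4,5) by (simp add: a_minus_def)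
qed

lemma additive_finsum:
  assumes "abelian_group G" "abelian_group P" "additive G P f"
    and "finite I" "\<And>i. i \<in> I \<Longrightarrow> g i \<in> carrier G"
  shows "f (\<Oplus>\<^bsub>G\<^esub>i\<in>I. g i) = (\<Oplus>\<^bsub>P\<^esub>i\<in>I. f (g i))"
proof -
  interpret G: abelian_group G by fact
  interpret P: abelian_group P by fact
  from assms(4,5) show ?thesis
  proof (induction I)
    case empty
    then show ?case using additive_zero[OF assms(1-3)] by simp
  next
    case (insert i I)
    then have "g \<in> I \<rightarrow> carrier G" "(\<lambda>i. f (g i)) \<in> I \<rightarrow> carrier P"
      using additive_closed[OF assms(3)] by auto
    with insert show ?case
      using additive_closed[OF assms(3)] by (simp add: additive_add[OF assms(3)])
  qed
qed

section \<open>Evaluation of formal integer combinations\<close>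

text \<open>The homomorphism from the free abelian group that extends g. The body repeats the sum
  inside \<open>tensor_lift\<close>, so that the two agree by unfolding.\<close>

definition frag_eval :: "('p,'q) ring_scheme \<Rightarrow> ('k \<Rightarrow> 'p) \<Rightarrow> ('k \<Rightarrow>\<^sub>0 int) \<Rightarrow> 'p" where
  "frag_eval P g c =
     (\<Oplus>\<^bsub>P\<^esub>k\<in>Poly_Mapping.keys c. [Poly_Mapping.lookup c k] \<cdot>\<^bsub>P\<^esub> g k)"

text \<open>Keys may cancel in a sum c + d, so the three sums in the homomorphism law run over
  different index sets. Terms with coefficient 0 vanish, which permits a common index set.\<close>

lemma (in abelian_group) frag_eval_superset:
  assumes "g \<in> S \<rightarrow> carrier G" "Poly_Mapping.keys c \<subseteq> K" "K \<subseteq> S" "finite K"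
  shows "frag_eval G g c = (\<Oplus>k\<in>K. [Poly_Mapping.lookup c k] \<cdot> g k)"
  unfolding frag_eval_def
proof (rule add.finprod_mono_neutral_cong_left)
  show "[Poly_Mapping.lookup c i] \<cdot> g i = \<zero>" if "i \<in> K - Poly_Mapping.keys c" for i
    using that by (simp add: in_keys_iff add_pow_def)
  show "(\<lambda>k. [Poly_Mapping.lookup c k] \<cdot> g k) \<in> K \<rightarrow> carrier G"
    using assms by blast
qed (use assms in auto)

lemma (in abelian_group) frag_eval_hom:
  assumes g: "g \<in> S \<rightarrow> carrier G"
  shows "frag_eval G g \<in> hom (free_Abelian_group S) (add_monoid G)"
proof (rule homI; simp)
  fix c d :: "'c \<Rightarrow>\<^sub>0 int"
  assume c: "Poly_Mapping.keys c \<subseteq> S"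
  show "frag_eval G g c \<in> carrier G"
    unfolding frag_eval_def using g c by (intro finsum_closed) blast
  assume d: "Poly_Mapping.keys d \<subseteq> S"
  let ?K = "Poly_Mapping.keys c \<union> Poly_Mapping.keys d"
  have K: "finite ?K" "?K \<subseteq> S" using c d by auto
  have cl: "g k \<in> carrier G" if "k \<in> ?K" for k using g K that by blast
  have "frag_eval G g (c + d) = (\<Oplus>k\<in>?K. [Poly_Mapping.lookup (c + d) k] \<cdot> g k)"
    by (rule frag_eval_superset[OF g keys_add K(2,1)])
  also have "\<dots> = (\<Oplus>k\<in>?K. [Poly_Mapping.lookup c k] \<cdot> g k \<oplus> [Poly_Mapping.lookup d k] \<cdot> g k)"
    by (rule finsum_cong')
       (use cl in \<open>auto simp: Poly_Mapping.lookup_add add.int_pow_mult\<close>)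
  also have "\<dots> = frag_eval G g c \<oplus> frag_eval G g d"
    using cl by (subst finsum_addf) (auto simp: frag_eval_superset[OF g _ K(2,1)])
  finally show "frag_eval G g (c + d) = frag_eval G g c \<oplus> frag_eval G g d" .
qed

lemma (in abelian_group) frag_eval_frag_of:
  assumes "g k \<in> carrier G"
  shows "frag_eval G g (frag_of k) = g k"
  using assms by (simp add: frag_eval_def)

section \<open>Balanced maps and the tensor product\<close>

text \<open>The target P is only an abelian group: the last clause compares two values of \<beta>
  and asks for no action of R on P.\<close>

definition balanced ::
  "('a,'r) ring_scheme \<Rightarrow> ('a,'m,'p) module_scheme \<Rightarrow> ('a,'n,'q) module_scheme
    \<Rightarrow> ('u,'v) ring_scheme \<Rightarrow> ('m \<Rightarrow> 'n \<Rightarrow> 'u) \<Rightarrow> bool"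
  where "balanced R M N P \<beta> \<longleftrightarrow>
    (\<forall>x\<in>carrier M. additive N P (\<beta> x)) \<and>
    (\<forall>y\<in>carrier N. additive M P (\<lambda>x. \<beta> x y)) \<and>
    (\<forall>r\<in>carrier R. \<forall>x\<in>carrier M. \<forall>y\<in>carrier N. \<beta> (r \<odot>\<^bsub>M\<^esub> x) y = \<beta> x (r \<odot>\<^bsub>N\<^esub> y))"

locale tensor_product = M: module R M + N: module R N
  for R :: "('a,'r) ring_scheme" and M :: "('a,'m,'p) module_scheme"
    and N :: "('a,'n,'q) module_scheme"
begin

abbreviation "F \<equiv> free_Abelian_group (carrier M \<times> carrier N)"
abbreviation "rel \<equiv> generate F (tensor_rels R M N)"
abbreviation "T \<equiv> tensor_grp R M N"
abbreviation pure :: "'m \<Rightarrow> 'n \<Rightarrow> ('m,'n) tensor" where "pure \<equiv> pure_tensor R M N"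

sublocale F: comm_group F
  by (rule abelian_free_Abelian_group)

lemma tensor_rels_closed: "tensor_rels R M N \<subseteq> carrier F"
proof -
  have *: "a - b \<in> carrier F" if "a \<in> carrier F" "b \<in> carrier F" for a b
    using that keys_diff[of a b] by (simp del: keys_diff) blast
  show ?thesis
    unfolding tensor_rels_def by (intro Un_least; clarify; intro *) auto
qed

sublocale rel: normal rel F
  by (intro F.normal_iff_subgroup[THEN iffD2] F.generate_is_subgroup tensor_rels_closed)

lemma add_monoid_tensor: "add_monoid T = F Mod rel"
  by (simp add: tensor_grp_def Let_def FactGroup_def)

lemma abelian_group_tensor: "abelian_group T"
proof -
  have "comm_group (add_monoid T)"
    unfolding add_monoid_tensor by (rule F.abelian_FactGroup) (rule rel.subgroup_axioms)
  then show ?thesis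
    by (simp add: abelian_group_def abelian_group_axioms_def abelian_monoid_def comm_group_def)
qed

sublocale T: abelian_group T
  by (rule abelian_group_tensor)

lemma group_tensor: "Group.group (add_monoid T)"
  by (rule abelian_group.a_group[OF abelian_group_tensor])

lemma carrier_tensor: "carrier T = (\<lambda>c. rel #>\<^bsub>F\<^esub> c) ` carrier F"
  using carrier_FactGroup[of F rel] by (simp flip: add_monoid_tensor)

lemma coset_hom: "(\<lambda>c. rel #>\<^bsub>F\<^esub> c) \<in> hom F (add_monoid T)"
  unfolding add_monoid_tensor by (rule rel.r_coset_hom_Mod)

lemma pure_eq: "pure x y = rel #>\<^bsub>F\<^esub> frag_of (x, y)"
  by (simp add: pure_tensor_def Let_def)

lemma pure_closed [simp, intro]: "x \<in> carrier M \<Longrightarrow> y \<in> carrier N \<Longrightarrow> pure x y \<in> carrier T"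
  by (simp add: pure_eq carrier_tensor)

text \<open>Each tensor is the coset of a formal combination, and the induction principle of the
  free abelian group proceeds by zero, differences and generators. Differences take care of negative
  coefficients, so that plain pure tensors suffice in the last case.\<close>

lemma tensor_induct [consumes 1, case_names zero diff pure]:
  assumes "X \<in> carrier T"
    and "Q \<zero>\<^bsub>T\<^esub>"
    and "\<And>X Y. X \<in> carrier T \<Longrightarrow> Y \<in> carrier T \<Longrightarrow> Q X \<Longrightarrow> Q Y \<Longrightarrow> Q (X \<ominus>\<^bsub>T\<^esub> Y)"
    and "\<And>x y. x \<in> carrier M \<Longrightarrow> y \<in> carrier N \<Longrightarrow> Q (pure x y)"
  shows "Q X"
proof -
  interpret c: group_hom F "add_monoid T" "\<lambda>c. rel #>\<^bsub>F\<^esub> c"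
    by (intro group_hom.intro group_hom_axioms.intro group_tensor coset_hom F.is_group)
  obtain c where c: "Poly_Mapping.keys c \<subseteq> carrier M \<times> carrier N" and X: "X = rel #>\<^bsub>F\<^esub> c"
    using assms(1) by (auto simp: carrier_tensor)
  from c have "Q (rel #>\<^bsub>F\<^esub> c)"
  proof (induction c rule: free_Abelian_group_induct[consumes 1])
    case 1
    then show ?case using assms(2) c.hom_one by simp
  next
    case (2 x y)
    have "- y \<in> carrier F" using 2 by (simp add: keys_minus)
    then have "rel #>\<^bsub>F\<^esub> (x - y) = (rel #>\<^bsub>F\<^esub> x) \<ominus>\<^bsub>T\<^esub> (rel #>\<^bsub>F\<^esub> y)"
      using c.hom_mult[of x "- y"] c.hom_inv[of y] 2 by (simp add: a_minus_def a_inv_def)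
    then show ?case using assms(3) 2 c.hom_closed by simp
  next
    case (3 k)
    then show ?case using assms(4) by (cases k) (simp add: pure_eq)
  qed
  then show ?thesis by (simp add: X)
qed

text \<open>The uniqueness half of the universal property, valid because pure tensors generate the
  group. Identities between maps on tensor products are checked through it.\<close>

lemma tensor_hom_eq:
  assumes "abelian_group P" "additive T P f" "additive T P g"
    and "\<And>x y. x \<in> carrier M \<Longrightarrow> y \<in> carrier N \<Longrightarrow> f (pure x y) = g (pure x y)"
    and "X \<in> carrier T"
  shows "f X = g X"
proof -
  from assms(5) show ?thesis
    by (induction X rule: tensor_induct)
       (simp_all add: additive_zero[OF T.abelian_group_axioms assms(1)]
          additive_minus[OF T.abelian_group_axioms assms(1)] assms(2-4))
qed

lemma rel_eqI:
  assumes "a \<in> carrier F" "b \<in> carrier F" "a - b \<in> rel"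
  shows "rel #>\<^bsub>F\<^esub> a = rel #>\<^bsub>F\<^esub> b"
proof (rule F.repr_independence[symmetric])
  have "a = (a - b) \<otimes>\<^bsub>F\<^esub> b" by simp
  with assms show "a \<in> rel #>\<^bsub>F\<^esub> b" unfolding r_coset_def by blast
qed (use assms rel.subgroup_axioms in auto)

lemma pure_add_left:
  assumes "x \<in> carrier M" "x' \<in> carrier M" "y \<in> carrier N"
  shows "pure (x \<oplus>\<^bsub>M\<^esub> x') y = pure x y \<oplus>\<^bsub>T\<^esub> pure x' y"
proof -
  have "frag_of (x \<oplus>\<^bsub>M\<^esub> x', y) - (frag_of (x, y) + frag_of (x', y)) \<in> rel"
    using assms by (intro generate.incl) (auto simp: tensor_rels_def algebra_simps)
  moreover have "frag_of (x, y) + frag_of (x', y) \<in> carrier F"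
    using F.m_closed[of "frag_of (x, y)" "frag_of (x', y)"] assms by simp
  ultimately show ?thesis
    using rel_eqI[of "frag_of (x \<oplus>\<^bsub>M\<^esub> x', y)"] hom_mult[OF coset_hom, of "frag_of (x, y)" "frag_of (x', y)"] assms
    by (simp add: pure_eq)
qed

lemma pure_add_right:
  assumes "x \<in> carrier M" "y \<in> carrier N" "y' \<in> carrier N"
  shows "pure x (y \<oplus>\<^bsub>N\<^esub> y') = pure x y \<oplus>\<^bsub>T\<^esub> pure x y'"
proof -
  have "frag_of (x, y \<oplus>\<^bsub>N\<^esub> y') - (frag_of (x, y) + frag_of (x, y')) \<in> rel"
    using assms by (intro generate.incl) (auto simp: tensor_rels_def algebra_simps)
  moreover have "frag_of (x, y) + frag_of (x, y') \<in> carrier F"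
    using F.m_closed[of "frag_of (x, y)" "frag_of (x, y')"] assms by simp
  ultimately show ?thesis
    using rel_eqI[of "frag_of (x, y \<oplus>\<^bsub>N\<^esub> y')"] hom_mult[OF coset_hom, of "frag_of (x, y)" "frag_of (x, y')"] assms
    by (simp add: pure_eq)
qed

lemma pure_smult:
  assumes "r \<in> carrier R" "x \<in> carrier M" "y \<in> carrier N"
  shows "pure (r \<odot>\<^bsub>M\<^esub> x) y = pure x (r \<odot>\<^bsub>N\<^esub> y)"
  unfolding pure_eq
proof (rule rel_eqI)
  show "frag_of (r \<odot>\<^bsub>M\<^esub> x, y) - frag_of (x, r \<odot>\<^bsub>N\<^esub> y) \<in> rel"
    using assms by (intro generate.incl) (auto simp: tensor_rels_def)
qed (use assms in auto)

context
  fixes P :: "('u,'v) ring_scheme" and \<beta> :: "'m \<Rightarrow> 'n \<Rightarrow> 'u"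
  assumes P: "abelian_group P" and \<beta>: "balanced R M N P \<beta>"
begin

interpretation P: abelian_group P by (rule P)

abbreviation (input) "E \<equiv> frag_eval P (case_prod \<beta>)"

lemma eval_hom: "E \<in> hom F (add_monoid P)"
  by (rule P.frag_eval_hom) (use \<beta> in \<open>auto simp: balanced_def additive_def\<close>)

interpretation E: group_hom F "add_monoid P" E
  using eval_hom by (simp add: group_hom_def group_hom_axioms_def P.a_group)

lemma eval_diff:
  assumes "a \<in> carrier F" "b \<in> carrier F"
  shows "E (a - b) = E a \<ominus>\<^bsub>P\<^esub> E b"
proof -
  have "- b \<in> carrier F" using assms by (simp add: keys_minus)
  then show ?thesis
    using E.hom_mult[of a "- b"] E.hom_inv[of b] assms by (simp add: a_minus_def a_inv_def)
qed

lemma eval_pair: "x \<in> carrier M \<Longrightarrow> y \<in> carrier N \<Longrightarrow> E (frag_of (x, y)) = \<beta> x y"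
  using \<beta> by (intro P.frag_eval_frag_of[THEN trans]) (auto simp: balanced_def additive_def)

text \<open>The kernel of a homomorphism is a subgroup, so it contains the subgroup generated by the
  relations as soon as it contains each of them; for the three kinds of relations this is exactly
  that \<beta> is balanced.\<close>

lemma eval_rel:
  assumes "a \<in> rel" shows "E a = \<zero>\<^bsub>P\<^esub>"
proof -
  have diff_closed: "a - b \<in> carrier F" if "a \<in> carrier F" "b \<in> carrier F" for a b
    using that keys_diff[of a b] by (simp del: keys_diff) blast
  have add_sub: "u \<oplus>\<^bsub>P\<^esub> v \<ominus>\<^bsub>P\<^esub> u \<ominus>\<^bsub>P\<^esub> v = \<zero>\<^bsub>P\<^esub>" if "u \<in> carrier P" "v \<in> carrier P" for u v
    using that by (simp add: a_minus_def P.a_assoc P.a_comm[of v] P.r_neg P.r_neg2)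
  have "tensor_rels R M N \<subseteq> kernel F (add_monoid P) E"
  proof
    fix a assume a: "a \<in> tensor_rels R M N"
    have "E a = \<zero>\<^bsub>P\<^esub>"
      using a \<beta> unfolding tensor_rels_def balanced_def additive_def
      by (auto simp: eval_diff eval_pair diff_closed add_sub P.r_neg[folded a_minus_def] Pi_iff
          simp del: carrier_free_Abelian_group_iff)
    then show "a \<in> kernel F (add_monoid P) E"
      using a tensor_rels_closed by (simp add: kernel_def subset_iff)
  qed
  then have "rel \<subseteq> kernel F (add_monoid P) E"
    by (intro F.generate_subgroup_incl E.subgroup_kernel)
  then show ?thesis using assms by (auto simp: kernel_def)
qed

text \<open>Since \<open>E\<close> vanishes on the relations, it is constant on each coset. Its
  image is therefore a singleton, and \<open>the_elem\<close> in \<open>tensor_lift\<close> returns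
  the expected value.\<close>

lemma tensor_lift_coset:
  assumes c: "c \<in> carrier F"
  shows "tensor_lift P \<beta> (rel #>\<^bsub>F\<^esub> c) = E c"
proof -
  have "E ` (rel #>\<^bsub>F\<^esub> c) = {E c}"
  proof -
    have "E d = E c" if "d \<in> rel #>\<^bsub>F\<^esub> c" for d
    proof -
      from that obtain r where r: "r \<in> rel" "d = r \<otimes>\<^bsub>F\<^esub> c" by (auto simp: r_coset_def)
      then have "r \<in> carrier F" using rel.subset by blast
      with r c show ?thesis
        using E.hom_mult[of r c] E.hom_closed[of c] by (simp add: eval_rel)
    qed
    moreover have "c \<in> rel #>\<^bsub>F\<^esub> c"
      using c by (rule F.rcos_self) (rule rel.subgroup_axioms)
    ultimately show ?thesis by blast
  qed
  then show ?thesis by (simp add: tensor_lift_def frag_eval_def)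
qed

text \<open>Together with additivity of the lift, the existence half of the universal
  property.\<close>

lemma tensor_lift_pure:
  "x \<in> carrier M \<Longrightarrow> y \<in> carrier N \<Longrightarrow> tensor_lift P \<beta> (pure x y) = \<beta> x y"
  by (simp add: pure_eq tensor_lift_coset eval_pair)

lemma tensor_lift_additive: "additive T P (tensor_lift P \<beta>)"
proof (rule additiveI)
  fix X assume "X \<in> carrier T"
  then obtain c where c: "c \<in> carrier F" "X = rel #>\<^bsub>F\<^esub> c" by (auto simp: carrier_tensor)
  then show "tensor_lift P \<beta> X \<in> carrier P"
    using E.hom_closed[of c] by (simp only: tensor_lift_coset) simp
  fix Y assume "Y \<in> carrier T"
  then obtain d where d: "d \<in> carrier F" "Y = rel #>\<^bsub>F\<^esub> d" by (auto simp: carrier_tensor)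
  have "X \<oplus>\<^bsub>T\<^esub> Y = rel #>\<^bsub>F\<^esub> (c \<otimes>\<^bsub>F\<^esub> d)"
    using hom_mult[OF coset_hom, of c d] c d by simp
  then show "tensor_lift P \<beta> (X \<oplus>\<^bsub>T\<^esub> Y) = tensor_lift P \<beta> X \<oplus>\<^bsub>P\<^esub> tensor_lift P \<beta> Y"
    using E.hom_mult[of c d] F.m_closed[of c d] c d by (simp only: tensor_lift_coset) simp
qed

end

end

section \<open>Linear combinations and matrices\<close>

lemma (in abelian_monoid) finsum_swap:
  assumes "finite I" "finite J" "\<And>i j. i \<in> I \<Longrightarrow> j \<in> J \<Longrightarrow> f i j \<in> carrier G"
  shows "(\<Oplus>i\<in>I. \<Oplus>j\<in>J. f i j) = (\<Oplus>j\<in>J. \<Oplus>i\<in>I. f i j)"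
  using assms(1,3)
proof (induction I)
  case empty
  then show ?case by simp
next
  case (insert k I)
  have "(\<Oplus>i\<in>insert k I. \<Oplus>j\<in>J. f i j) = (\<Oplus>j\<in>J. f k j) \<oplus> (\<Oplus>j\<in>J. \<Oplus>i\<in>I. f i j)"
    using insert by (subst finsum_insert) auto
  also have "\<dots> = (\<Oplus>j\<in>J. f k j \<oplus> (\<Oplus>i\<in>I. f i j))"
    using insert.prems by (subst finsum_addf) auto
  also have "\<dots> = (\<Oplus>j\<in>J. \<Oplus>i\<in>insert k I. f i j)"
    using insert by (intro finsum_cong') (auto intro!: finsum_insert[symmetric])
  finally show ?case .
qed

lemma PiE_funcset: "f \<in> A \<rightarrow>\<^sub>E B \<Longrightarrow> f \<in> A \<rightarrow> B"
  by auto

lemma free_module_simps [simp]: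
  "carrier (free_module R n) = ({..<n} \<rightarrow>\<^sub>E carrier R)"
  "\<zero>\<^bsub>free_module R n\<^esub> = (\<lambda>i\<in>{..<n}. \<zero>\<^bsub>R\<^esub>)"
  "v \<oplus>\<^bsub>free_module R n\<^esub> w = (\<lambda>i\<in>{..<n}. v i \<oplus>\<^bsub>R\<^esub> w i)"
  "r \<odot>\<^bsub>free_module R n\<^esub> v = (\<lambda>i\<in>{..<n}. r \<otimes>\<^bsub>R\<^esub> v i)"
  by (simp_all add: free_module_def)

lemma (in cring) module_free_module: "module R (free_module R n)"
proof (rule moduleI)
  show "abelian_group (free_module R n)"
  proof (rule abelian_groupI)
    fix v assume v: "v \<in> carrier (free_module R n)"
    show "\<exists>w\<in>carrier (free_module R n). w \<oplus>\<^bsub>free_module R n\<^esub> v = \<zero>\<^bsub>free_module R n\<^esub>"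
      by (rule bexI[of _ "\<lambda>i\<in>{..<n}. \<ominus> v i"])
         (use v in \<open>simp_all add: fun_eq_iff l_neg PiE_iff\<close>)
    show "\<zero>\<^bsub>free_module R n\<^esub> \<oplus>\<^bsub>free_module R n\<^esub> v = v"
      using v by (simp add: fun_eq_iff PiE_iff extensional_def)
  qed (simp_all add: fun_eq_iff PiE_iff a_ac)
  show "\<one> \<odot>\<^bsub>free_module R n\<^esub> v = v" if "v \<in> carrier (free_module R n)" for v
    using that by (simp add: fun_eq_iff PiE_iff extensional_def)
qed (simp_all add: fun_eq_iff PiE_iff l_distr r_distr m_assoc is_cring)

lemma ring_as_module_simps [simp]:
  "carrier (ring_as_module S h) = carrier S"
  "\<zero>\<^bsub>ring_as_module S h\<^esub> = \<zero>\<^bsub>S\<^esub>"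
  "s \<oplus>\<^bsub>ring_as_module S h\<^esub> t = s \<oplus>\<^bsub>S\<^esub> t"
  "r \<odot>\<^bsub>ring_as_module S h\<^esub> s = h r \<otimes>\<^bsub>S\<^esub> s"
  by (simp_all add: ring_as_module_def)

lemma module_ring_as_module:
  assumes "cring R" "cring S" "h \<in> ring_hom R S"
  shows "module R (ring_as_module S h)"
proof -
  interpret R: cring R by fact
  interpret S: cring S by fact
  show ?thesis
  proof (rule moduleI)
    show "abelian_group (ring_as_module S h)"
    proof (rule abelian_groupI)
      show "\<exists>y\<in>carrier (ring_as_module S h). y \<oplus>\<^bsub>ring_as_module S h\<^esub> x = \<zero>\<^bsub>ring_as_module S h\<^esub>"
        if "x \<in> carrier (ring_as_module S h)" for x
        using that by (intro bexI[of _ "\<ominus>\<^bsub>S\<^esub> x"]) (simp_all add: S.l_neg)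
    qed (simp_all add: S.a_ac)
  qed (simp_all add: R.is_cring ring_hom_closed[OF assms(3)] ring_hom_add[OF assms(3)]
      ring_hom_mult[OF assms(3)] ring_hom_one[OF assms(3)] S.l_distr S.r_distr S.m_assoc)
qed

section \<open>Linear combinations as maps out of free modules\<close>

text \<open>The product of the row x of module elements with the column w of scalars, that is, the
  map R^n \<rightarrow> M sending the unit vectors to x. Indexing by numbers rather than by a set of
  generators allows repetitions and zeros.\<close>

definition lin_comb ::
  "('a,'m,'p) module_scheme \<Rightarrow> nat \<Rightarrow> (nat \<Rightarrow> 'm) \<Rightarrow> (nat \<Rightarrow> 'a) \<Rightarrow> 'm"
  where "lin_comb M n x w = (\<Oplus>\<^bsub>M\<^esub>i\<in>{..<n}. w i \<odot>\<^bsub>M\<^esub> x i)"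

context module
begin

lemma lin_comb_closed:
  assumes "x \<in> {..<n} \<rightarrow> carrier M" "w \<in> {..<n} \<rightarrow> carrier R"
  shows "lin_comb M n x w \<in> carrier M"
  unfolding lin_comb_def using assms by (intro M.finsum_closed) auto

text \<open>Only the products have to agree. Coefficients may thus be changed freely wherever the
  module element is zero, which is how \<open>block_matrix\<close> clears rows.\<close>

lemma lin_comb_cong:
  assumes "y \<in> {..<n} \<rightarrow> carrier M" "w \<in> {..<n} \<rightarrow> carrier R"
    and "\<And>i. i < n \<Longrightarrow> v i \<odot>\<^bsub>M\<^esub> x i = w i \<odot>\<^bsub>M\<^esub> y i"
  shows "lin_comb M n x v = lin_comb M n y w"
  unfolding lin_comb_def using assms by (intro M.finsum_cong') auto

lemma lin_comb_add:
  assumes "x \<in> {..<n} \<rightarrow> carrier M" "v \<in> {..<n} \<rightarrow> carrier R" "w \<in> {..<n} \<rightarrow> carrier R"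
  shows "lin_comb M n x (\<lambda>i\<in>{..<n}. v i \<oplus> w i) = lin_comb M n x v \<oplus>\<^bsub>M\<^esub> lin_comb M n x w"
proof -
  have "lin_comb M n x (\<lambda>i\<in>{..<n}. v i \<oplus> w i) =
      (\<Oplus>\<^bsub>M\<^esub>i\<in>{..<n}. v i \<odot>\<^bsub>M\<^esub> x i \<oplus>\<^bsub>M\<^esub> w i \<odot>\<^bsub>M\<^esub> x i)"
    unfolding lin_comb_def using assms by (intro M.finsum_cong') (auto simp: smult_l_distr Pi_iff)
  also have "\<dots> = lin_comb M n x v \<oplus>\<^bsub>M\<^esub> lin_comb M n x w"
    unfolding lin_comb_def using assms by (intro M.finsum_addf) auto
  finally show ?thesis .
qed

lemma lin_comb_smult:
  assumes "x \<in> {..<n} \<rightarrow> carrier M" "r \<in> carrier R" "w \<in> {..<n} \<rightarrow> carrier R"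
  shows "lin_comb M n x (\<lambda>i\<in>{..<n}. r \<otimes> w i) = r \<odot>\<^bsub>M\<^esub> lin_comb M n x w"
proof -
  have "lin_comb M n x (\<lambda>i\<in>{..<n}. r \<otimes> w i) = (\<Oplus>\<^bsub>M\<^esub>i\<in>{..<n}. r \<odot>\<^bsub>M\<^esub> (w i \<odot>\<^bsub>M\<^esub> x i))"
    unfolding lin_comb_def using assms by (intro M.finsum_cong') (auto simp: smult_assoc1 Pi_iff)
  also have "\<dots> = r \<odot>\<^bsub>M\<^esub> lin_comb M n x w"
    unfolding lin_comb_def using assms by (intro finsum_smult_ldistr[symmetric]) auto
  finally show ?thesis .
qed

lemma lin_comb_hom:
  assumes "x \<in> {..<n} \<rightarrow> carrier M"
  shows "lin_comb M n x \<in> mod_homs R (free_module R n) M"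
  unfolding mod_homs_def
  using assms by (auto simp: lin_comb_add lin_comb_smult lin_comb_closed PiE_iff Pi_iff)

text \<open>Associativity x (A w) = (x A) w, by exchanging the two summations; entry j of the row x
  A is the combination with column j of A as coefficients.\<close>

lemma lin_comb_mat_vec:
  assumes x: "x \<in> {..<n} \<rightarrow> carrier M" and A: "A \<in> {..<n} \<times> {..<n} \<rightarrow> carrier R"
    and w: "w \<in> {..<n} \<rightarrow> carrier R"
  shows "lin_comb M n x (mat_vec R n A w) = lin_comb M n (\<lambda>j. lin_comb M n x (\<lambda>i. A (i,j))) w"
proof -
  have A': "A (i,j) \<in> carrier R" if "i < n" "j < n" for i j using A that by auto
  have x': "x i \<in> carrier M" if "i < n" for i using x that by auto
  have w': "w i \<in> carrier R" if "i < n" for i using w that by auto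
  have "lin_comb M n x (mat_vec R n A w) =
      (\<Oplus>\<^bsub>M\<^esub>i\<in>{..<n}. \<Oplus>\<^bsub>M\<^esub>j\<in>{..<n}. (A (i,j) \<otimes> w j) \<odot>\<^bsub>M\<^esub> x i)"
    unfolding lin_comb_def mat_vec_def
  proof (rule M.finsum_cong'; clarsimp)
    fix i assume i: "i < n"
    have "additive R M (\<lambda>a. a \<odot>\<^bsub>M\<^esub> x i)"
      using x' i by (intro additiveI) (auto simp: smult_l_distr)
    then show "(\<Oplus>j\<in>{..<n}. A (i,j) \<otimes> w j) \<odot>\<^bsub>M\<^esub> x i = (\<Oplus>\<^bsub>M\<^esub>j\<in>{..<n}. (A (i,j) \<otimes> w j) \<odot>\<^bsub>M\<^esub> x i)"
      using A' w' i
      by (intro additive_finsum[OF R.abelian_group_axioms M.abelian_group_axioms]) auto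
  qed (auto intro!: M.finsum_closed simp: A' w' x')
  also have "\<dots> = (\<Oplus>\<^bsub>M\<^esub>j\<in>{..<n}. \<Oplus>\<^bsub>M\<^esub>i\<in>{..<n}. (A (i,j) \<otimes> w j) \<odot>\<^bsub>M\<^esub> x i)"
    using A' w' x' by (intro M.finsum_swap) auto
  also have "\<dots> = lin_comb M n (\<lambda>j. lin_comb M n x (\<lambda>i. A (i,j))) w"
    unfolding lin_comb_def
  proof (rule M.finsum_cong'; clarsimp)
    fix j assume j: "j < n"
    have "w j \<odot>\<^bsub>M\<^esub> (\<Oplus>\<^bsub>M\<^esub>i\<in>{..<n}. A (i,j) \<odot>\<^bsub>M\<^esub> x i) =
        (\<Oplus>\<^bsub>M\<^esub>i\<in>{..<n}. w j \<odot>\<^bsub>M\<^esub> (A (i,j) \<odot>\<^bsub>M\<^esub> x i))"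
      using A' w' x' j by (intro finsum_smult_ldistr) auto
    also have "\<dots> = (\<Oplus>\<^bsub>M\<^esub>i\<in>{..<n}. (A (i,j) \<otimes> w j) \<odot>\<^bsub>M\<^esub> x i)"
      using A' w' x' j by (intro M.finsum_cong') (auto simp: R.m_comm smult_assoc1)
    finally show "(\<Oplus>\<^bsub>M\<^esub>i\<in>{..<n}. (A (i,j) \<otimes> w j) \<odot>\<^bsub>M\<^esub> x i) =
        w j \<odot>\<^bsub>M\<^esub> (\<Oplus>\<^bsub>M\<^esub>i\<in>{..<n}. A (i,j) \<odot>\<^bsub>M\<^esub> x i)" by simp
  qed (auto intro!: M.finsum_closed smult_closed simp: A' w' x')
  finally show ?thesis .
qed

end

section \<open>Square matrices acting on vectors\<close>

context cring
begin

text \<open>Over itself the ring makes each row of a matrix a family of module elements, so that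
  matrix products become instances of \<open>lin_comb\<close>.\<close>

lemma module_self: "module R (ring_as_module R id)"
  by (rule module_ring_as_module[OF is_cring is_cring]) (simp add: ring_hom_def)

lemma lin_comb_self: "lin_comb (ring_as_module R id) n x w = (\<Oplus>i\<in>{..<n}. w i \<otimes> x i)"
  by (simp add: lin_comb_def ring_as_module_def finsum_def finprod_def)

lemma mat_vec_closed:
  assumes "A \<in> {..<n} \<times> {..<n} \<rightarrow> carrier R" "w \<in> {..<n} \<rightarrow> carrier R"
  shows "mat_vec R n A w \<in> {..<n} \<rightarrow>\<^sub>E carrier R"
  using assms by (auto simp: mat_vec_def intro!: finsum_closed m_closed)

lemma mat_vec_add:
  assumes "A \<in> {..<n} \<times> {..<n} \<rightarrow> carrier R" "v \<in> {..<n} \<rightarrow> carrier R" "w \<in> {..<n} \<rightarrow> carrier R"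
  shows "mat_vec R n A (\<lambda>i\<in>{..<n}. v i \<oplus> w i) = (\<lambda>i\<in>{..<n}. mat_vec R n A v i \<oplus> mat_vec R n A w i)"
proof -
  have "(\<Oplus>j\<in>{..<n}. A (i,j) \<otimes> (\<lambda>i\<in>{..<n}. v i \<oplus> w i) j) =
     (\<Oplus>j\<in>{..<n}. A (i,j) \<otimes> v j) \<oplus> (\<Oplus>j\<in>{..<n}. A (i,j) \<otimes> w j)" if "i < n" for i
  proof -
    have "(\<Oplus>j\<in>{..<n}. A (i,j) \<otimes> (\<lambda>i\<in>{..<n}. v i \<oplus> w i) j) =
       (\<Oplus>j\<in>{..<n}. A (i,j) \<otimes> v j \<oplus> A (i,j) \<otimes> w j)"
      using assms that by (intro finsum_cong') (auto simp: r_distr Pi_iff)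
    then show ?thesis using assms that by (subst finsum_addf[symmetric]) auto
  qed
  then show ?thesis by (auto simp: mat_vec_def intro!: restrict_ext)
qed

lemma mat_vec_smult:
  assumes "A \<in> {..<n} \<times> {..<n} \<rightarrow> carrier R" "r \<in> carrier R" "w \<in> {..<n} \<rightarrow> carrier R"
  shows "mat_vec R n A (\<lambda>i\<in>{..<n}. r \<otimes> w i) = (\<lambda>i\<in>{..<n}. r \<otimes> mat_vec R n A w i)"
proof -
  have "(\<Oplus>j\<in>{..<n}. A (i,j) \<otimes> (\<lambda>i\<in>{..<n}. r \<otimes> w i) j) = r \<otimes> (\<Oplus>j\<in>{..<n}. A (i,j) \<otimes> w j)"
    if "i < n" for i
  proof -
    have "(\<Oplus>j\<in>{..<n}. A (i,j) \<otimes> (\<lambda>i\<in>{..<n}. r \<otimes> w i) j) =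
       (\<Oplus>j\<in>{..<n}. r \<otimes> (A (i,j) \<otimes> w j))"
      using assms that by (intro finsum_cong') (auto simp: m_lcomm Pi_iff)
    then show ?thesis using assms that by (subst finsum_rdistr) auto
  qed
  then show ?thesis by (auto simp: mat_vec_def intro!: restrict_ext)
qed

lemma mat_monoid_simps [simp]:
  "carrier (mat_monoid R n) = ({..<n} \<times> {..<n} \<rightarrow>\<^sub>E carrier R)"
  "\<one>\<^bsub>mat_monoid R n\<^esub> = (\<lambda>(i,j)\<in>{..<n} \<times> {..<n}. if i = j then \<one> else \<zero>)"
  by (simp_all add: mat_monoid_def)

text \<open>Column j of a product is the left factor applied to column j of the right one;
  identities between matrices thus reduce to identities between vectors.\<close>

lemma mat_mult_col:
  assumes "i < n" "j < n"
  shows "(A \<otimes>\<^bsub>mat_monoid R n\<^esub> B) (i,j) = mat_vec R n A (\<lambda>k. B (k,j)) i"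
  using assms by (simp add: mat_monoid_def mat_vec_def)

lemma mat_mult_closed:
  assumes "A \<in> {..<n} \<times> {..<n} \<rightarrow> carrier R" "B \<in> {..<n} \<times> {..<n} \<rightarrow> carrier R"
  shows "A \<otimes>\<^bsub>mat_monoid R n\<^esub> B \<in> {..<n} \<times> {..<n} \<rightarrow>\<^sub>E carrier R"
  using assms by (auto simp: mat_monoid_def intro!: finsum_closed m_closed)

text \<open>Row i of A is a family in the ring viewed as a module, so entry i of the claim is
  \<open>lin_comb_mat_vec\<close> for that module, up to commuting the factors.\<close>

lemma mat_vec_mult:
  assumes A: "A \<in> {..<n} \<times> {..<n} \<rightarrow> carrier R" and B: "B \<in> {..<n} \<times> {..<n} \<rightarrow> carrier R"
    and w: "w \<in> {..<n} \<rightarrow> carrier R"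
  shows "mat_vec R n (A \<otimes>\<^bsub>mat_monoid R n\<^esub> B) w = mat_vec R n A (mat_vec R n B w)"
proof
  fix i
  show "mat_vec R n (A \<otimes>\<^bsub>mat_monoid R n\<^esub> B) w i = mat_vec R n A (mat_vec R n B w) i"
  proof (cases "i < n")
    case i: True
    interpret S: module R "ring_as_module R id" by (rule module_self)
    have c: "carrier (ring_as_module R id) = carrier R" by (simp add: ring_as_module_def)
    have A': "A (i,j) \<in> carrier R" if "j < n" for j using A i that by auto
    have B': "B (k,j) \<in> carrier R" if "j < n" "k < n" for k j using B that by auto
    have w': "w j \<in> carrier R" if "j < n" for j using w that by auto
    have "mat_vec R n A (mat_vec R n B w) i =
        lin_comb (ring_as_module R id) n (\<lambda>k. A (i,k)) (mat_vec R n B w)"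
      unfolding lin_comb_self mat_vec_def[of R n A] restrict_apply'[OF lessThan_iff[THEN iffD2, OF i]]
      using mat_vec_closed[OF B w] A' by (intro finsum_cong' refl funcsetI m_closed m_comm) auto
    also have "\<dots> = lin_comb (ring_as_module R id) n
        (\<lambda>j. lin_comb (ring_as_module R id) n (\<lambda>k. A (i,k)) (\<lambda>k. B (k,j))) w"
      using A' B w by (intro S.lin_comb_mat_vec) (auto simp: c)
    also have "\<dots> = mat_vec R n (A \<otimes>\<^bsub>mat_monoid R n\<^esub> B) w i"
      unfolding lin_comb_self mat_vec_def[of R n "A \<otimes>\<^bsub>mat_monoid R n\<^esub> B"] restrict_apply'[OF lessThan_iff[THEN iffD2, OF i]]
    proof (rule finsum_cong')
      fix j assume "j \<in> {..<n}"
      then have j: "j < n" by simp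
      have "(\<Oplus>k\<in>{..<n}. B (k,j) \<otimes> A (i,k)) = (\<Oplus>k\<in>{..<n}. A (i,k) \<otimes> B (k,j))"
        using A' B' j by (intro finsum_cong') (auto intro: m_comm)
      moreover have "(\<Oplus>k\<in>{..<n}. A (i,k) \<otimes> B (k,j)) \<in> carrier R"
        using A' B' j by (intro finsum_closed) auto
      ultimately show "w j \<otimes> (\<Oplus>k\<in>{..<n}. B (k,j) \<otimes> A (i,k)) = (A \<otimes>\<^bsub>mat_monoid R n\<^esub> B) (i,j) \<otimes> w j"
        using i j w' by (simp add: mat_mult_col mat_vec_def m_comm)
    qed (use mat_mult_closed[OF A B] w' i in auto)
    finally show ?thesis by simp
  qed (simp add: mat_vec_def)
qed

lemma mat_one_closed: "\<one>\<^bsub>mat_monoid R n\<^esub> \<in> {..<n} \<times> {..<n} \<rightarrow>\<^sub>E carrier R"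
  by (rule PiE_I) auto

text \<open>The vector has to be extensional here, because \<open>mat_vec\<close> returns
  \<open>undefined\<close> outside of the index range.\<close>

lemma mat_vec_one:
  assumes "w \<in> {..<n} \<rightarrow>\<^sub>E carrier R"
  shows "mat_vec R n \<one>\<^bsub>mat_monoid R n\<^esub> w = w"
proof (rule PiE_ext[OF mat_vec_closed assms])
  fix i assume i: "i \<in> {..<n}"
  have w': "w j \<in> carrier R" if "j < n" for j using assms that by auto
  have "mat_vec R n \<one>\<^bsub>mat_monoid R n\<^esub> w i = (\<Oplus>j\<in>{..<n}. if i = j then w j else \<zero>)"
    unfolding mat_vec_def restrict_apply'[OF i]
  proof (rule finsum_cong')
    show "\<one>\<^bsub>mat_monoid R n\<^esub> (i,j) \<otimes> w j = (if i = j then w j else \<zero>)" if "j \<in> {..<n}" for j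
      using i that w' by simp
  qed (use w' in auto)
  also have "\<dots> = w i" using i w' by (intro add.finprod_singleton) simp_all
  finally show "mat_vec R n \<one>\<^bsub>mat_monoid R n\<^esub> w i = w i" .
qed (rule PiE_funcset mat_one_closed assms)+

text \<open>\<open>GL\<close> is the set of units of this structure; the monoid laws are what makes
  it closed under products.\<close>

lemma monoid_mat_monoid: "monoid (mat_monoid R n)"
proof (rule monoidI)
  show "A \<otimes>\<^bsub>mat_monoid R n\<^esub> B \<in> carrier (mat_monoid R n)"
    if "A \<in> carrier (mat_monoid R n)" "B \<in> carrier (mat_monoid R n)" for A B
    using that by (simp only: mat_monoid_simps(1), intro mat_mult_closed) auto
  fix A B C
  assume A: "A \<in> carrier (mat_monoid R n)" and B: "B \<in> carrier (mat_monoid R n)"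
  then have A': "A \<in> {..<n} \<times> {..<n} \<rightarrow> carrier R" and B': "B \<in> {..<n} \<times> {..<n} \<rightarrow> carrier R"
    by auto
  assume C: "C \<in> carrier (mat_monoid R n)"
  then have C': "C \<in> {..<n} \<times> {..<n} \<rightarrow> carrier R" by auto
  have AB: "A \<otimes>\<^bsub>mat_monoid R n\<^esub> B \<in> {..<n} \<times> {..<n} \<rightarrow> carrier R"
    and BC: "B \<otimes>\<^bsub>mat_monoid R n\<^esub> C \<in> {..<n} \<times> {..<n} \<rightarrow> carrier R"
    using mat_mult_closed[OF A' B'] mat_mult_closed[OF B' C'] by auto
  show "A \<otimes>\<^bsub>mat_monoid R n\<^esub> B \<otimes>\<^bsub>mat_monoid R n\<^esub> C = A \<otimes>\<^bsub>mat_monoid R n\<^esub> (B \<otimes>\<^bsub>mat_monoid R n\<^esub> C)"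
  proof (rule PiE_ext[OF mat_mult_closed[OF AB C'] mat_mult_closed[OF A' BC]], clarify)
    fix i j assume ij: "i < n" "j < n"
    then have Cj: "(\<lambda>k. C (k,j)) \<in> {..<n} \<rightarrow> carrier R" using C' by auto
    have "mat_vec R n A (mat_vec R n B (\<lambda>k. C (k,j))) i =
        mat_vec R n A (\<lambda>k. (B \<otimes>\<^bsub>mat_monoid R n\<^esub> C) (k,j)) i"
      using ij A' BC mat_mult_col[of _ n j B C, symmetric]
      unfolding mat_vec_def[of R n A] by (auto intro!: finsum_cong')
    then show "(A \<otimes>\<^bsub>mat_monoid R n\<^esub> B \<otimes>\<^bsub>mat_monoid R n\<^esub> C) (i,j) =
        (A \<otimes>\<^bsub>mat_monoid R n\<^esub> (B \<otimes>\<^bsub>mat_monoid R n\<^esub> C)) (i,j)"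
      using ij mat_vec_mult[OF A' B' Cj] by (simp add: mat_mult_col)
  qed
next
  fix A assume A: "A \<in> carrier (mat_monoid R n)"
  then have A': "A (i,j) \<in> carrier R" if "i < n" "j < n" for i j using that by auto
  have one: "\<one>\<^bsub>mat_monoid R n\<^esub> \<in> {..<n} \<times> {..<n} \<rightarrow> carrier R"
    by (rule PiE_funcset[OF mat_one_closed])
  have Ap: "A \<in> {..<n} \<times> {..<n} \<rightarrow>\<^sub>E carrier R" and Af: "A \<in> {..<n} \<times> {..<n} \<rightarrow> carrier R"
    using A by auto
  show "\<one>\<^bsub>mat_monoid R n\<^esub> \<otimes>\<^bsub>mat_monoid R n\<^esub> A = A"
  proof (rule PiE_ext[OF mat_mult_closed[OF one Af] Ap], clarify)
    fix i j assume ij: "i < n" "j < n"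
    have "mat_vec R n \<one>\<^bsub>mat_monoid R n\<^esub> (\<lambda>k. A (k,j)) i =
        mat_vec R n \<one>\<^bsub>mat_monoid R n\<^esub> (\<lambda>k\<in>{..<n}. A (k,j)) i"
      using ij A' one unfolding mat_vec_def by (auto intro!: finsum_cong')
    also have "\<dots> = A (i,j)"
      using ij A' by (subst mat_vec_one) auto
    finally show "(\<one>\<^bsub>mat_monoid R n\<^esub> \<otimes>\<^bsub>mat_monoid R n\<^esub> A) (i,j) = A (i,j)"
      using ij by (simp add: mat_mult_col del: mat_monoid_simps)
  qed
  show "A \<otimes>\<^bsub>mat_monoid R n\<^esub> \<one>\<^bsub>mat_monoid R n\<^esub> = A"
  proof (rule PiE_ext[OF mat_mult_closed[OF Af one] Ap], clarify)
    fix i j assume ij: "i < n" "j < n"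
    have "(A \<otimes>\<^bsub>mat_monoid R n\<^esub> \<one>\<^bsub>mat_monoid R n\<^esub>) (i,j) = (\<Oplus>k\<in>{..<n}. if j = k then A (i,k) else \<zero>)"
      unfolding mat_mult_col[OF ij] mat_vec_def restrict_apply'[OF lessThan_iff[THEN iffD2, OF ij(1)]]
    proof (rule finsum_cong')
      show "A (i,k) \<otimes> \<one>\<^bsub>mat_monoid R n\<^esub> (k,j) = (if j = k then A (i,k) else \<zero>)" if "k \<in> {..<n}" for k
        using ij that A' by simp
    qed (use ij A' in auto)
    also have "\<dots> = A (i,j)"
      using ij A' by (intro add.finprod_singleton) auto
    finally show "(A \<otimes>\<^bsub>mat_monoid R n\<^esub> \<one>\<^bsub>mat_monoid R n\<^esub>) (i,j) = A (i,j)" .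
  qed
qed auto

lemma mat_vec_GL_bij:
  assumes "A \<in> GL n R"
  shows "bij_betw (mat_vec R n A) ({..<n} \<rightarrow>\<^sub>E carrier R) ({..<n} \<rightarrow>\<^sub>E carrier R)"
proof -
  obtain B where A: "A \<in> {..<n} \<times> {..<n} \<rightarrow>\<^sub>E carrier R" and B: "B \<in> {..<n} \<times> {..<n} \<rightarrow>\<^sub>E carrier R"
    and AB: "A \<otimes>\<^bsub>mat_monoid R n\<^esub> B = \<one>\<^bsub>mat_monoid R n\<^esub>" "B \<otimes>\<^bsub>mat_monoid R n\<^esub> A = \<one>\<^bsub>mat_monoid R n\<^esub>"
    using assms by (auto simp: GL_def Units_def simp del: mat_monoid_simps(2))
  then have A': "A \<in> {..<n} \<times> {..<n} \<rightarrow> carrier R" and B': "B \<in> {..<n} \<times> {..<n} \<rightarrow> carrier R"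
    by auto
  have "mat_vec R n B (mat_vec R n A w) = w" "mat_vec R n A (mat_vec R n B w) = w"
    if "w \<in> {..<n} \<rightarrow>\<^sub>E carrier R" for w
  proof -
    have "w \<in> {..<n} \<rightarrow> carrier R" using that by auto
    then show "mat_vec R n B (mat_vec R n A w) = w" "mat_vec R n A (mat_vec R n B w) = w"
      using mat_vec_mult[OF A' B', of w] mat_vec_mult[OF B' A', of w] mat_vec_one[OF that]
      unfolding AB by simp_all
  qed
  then show ?thesis
    by (intro bij_betw_byWitness[where f' = "mat_vec R n B"] image_subsetI ballI
        mat_vec_closed A' B') (auto simp: PiE_iff)
qed

end

section \<open>Unipotent block matrices\<close>

text \<open>The matrix 1 + D. The restriction puts it into the carrier of \<open>mat_monoid\<close>
  even if D itself is not extensional.\<close>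

definition one_plus :: "('a,'r) ring_scheme \<Rightarrow> nat \<Rightarrow> (nat \<times> nat \<Rightarrow> 'a) \<Rightarrow> nat \<times> nat \<Rightarrow> 'a"
  where "one_plus R n D = (\<lambda>(i,j)\<in>{..<n} \<times> {..<n}. (if i = j then \<one>\<^bsub>R\<^esub> else \<zero>\<^bsub>R\<^esub>) \<oplus>\<^bsub>R\<^esub> D (i,j))"

context cring
begin

lemma one_plus_closed:
  assumes "D \<in> {..<n} \<times> {..<n} \<rightarrow> carrier R"
  shows "one_plus R n D \<in> {..<n} \<times> {..<n} \<rightarrow>\<^sub>E carrier R"
proof (rule PiE_I)
  fix p assume p: "p \<in> {..<n} \<times> {..<n}"
  then have "D p \<in> carrier R" using assms by blast
  with p show "one_plus R n D p \<in> carrier R" by (cases p) (simp add: one_plus_def)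
qed (auto simp: one_plus_def)

lemma mat_vec_one_plus:
  assumes "D \<in> {..<n} \<times> {..<n} \<rightarrow> carrier R" "w \<in> {..<n} \<rightarrow> carrier R" "i < n"
  shows "mat_vec R n (one_plus R n D) w i = w i \<oplus> mat_vec R n D w i"
proof -
  have D: "D (i,j) \<in> carrier R" and w: "w j \<in> carrier R" if "j < n" for j
    using assms that by auto
  have "mat_vec R n (one_plus R n D) w i =
      (\<Oplus>j\<in>{..<n}. (if i = j then w j else \<zero>) \<oplus> D (i,j) \<otimes> w j)"
    unfolding mat_vec_def restrict_apply'[OF lessThan_iff[THEN iffD2, OF assms(3)]]
  proof (rule finsum_cong')
    fix j assume j: "j \<in> {..<n}"
    then show "one_plus R n D (i,j) \<otimes> w j = (if i = j then w j else \<zero>) \<oplus> D (i,j) \<otimes> w j"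
      using assms(3) D w by (simp add: one_plus_def l_distr)
  qed (use D w in auto)
  also have "\<dots> = (\<Oplus>j\<in>{..<n}. if i = j then w j else \<zero>) \<oplus> (\<Oplus>j\<in>{..<n}. D (i,j) \<otimes> w j)"
    using D w by (intro finsum_addf) auto
  also have "(\<Oplus>j\<in>{..<n}. if i = j then w j else \<zero>) = w i"
    using w assms(3) by (intro add.finprod_singleton) simp_all
  finally show ?thesis using assms(3) by (simp add: mat_vec_def)
qed

text \<open>(1 + D) (1 + D') = 1 + (D + D') + D D'. The hypothesis asks that every single term in
  the entries of D D' vanish, which block matrices satisfy, so no sum has to be cancelled.\<close>

lemma one_plus_mult:
  assumes D: "D \<in> {..<n} \<times> {..<n} \<rightarrow> carrier R" and D': "D' \<in> {..<n} \<times> {..<n} \<rightarrow> carrier R"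
    and sum: "\<And>i j. i < n \<Longrightarrow> j < n \<Longrightarrow> D (i,j) \<oplus> D' (i,j) = \<zero>"
    and prod: "\<And>i j k. i < n \<Longrightarrow> j < n \<Longrightarrow> k < n \<Longrightarrow> D (i,k) \<otimes> D' (k,j) = \<zero>"
  shows "one_plus R n D \<otimes>\<^bsub>mat_monoid R n\<^esub> one_plus R n D' = \<one>\<^bsub>mat_monoid R n\<^esub>"
proof (rule PiE_ext[OF mat_mult_closed mat_one_closed], (rule D D' one_plus_closed PiE_funcset)+, clarify)
  fix i j assume ij: "i < n" "j < n"
  have Dc: "D (i,k) \<in> carrier R" and D'c: "D' (k,j) \<in> carrier R" if "k < n" for k
    using D D' ij that by auto
  have w: "(\<lambda>k. one_plus R n D' (k,j)) \<in> {..<n} \<rightarrow> carrier R"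
    using one_plus_closed[OF D'] ij by auto
  \<comment> \<open>Column j of 1 + D' is the unit vector plus column j of D', and D annihilates the
    latter term by term; what is left is entry (i,j) of D.\<close>
  have "mat_vec R n D (\<lambda>k. one_plus R n D' (k,j)) i = (\<Oplus>k\<in>{..<n}. if j = k then D (i,k) else \<zero>)"
    unfolding mat_vec_def restrict_apply'[OF lessThan_iff[THEN iffD2, OF ij(1)]]
  proof (rule finsum_cong')
    fix k assume "k \<in> {..<n}"
    then show "D (i,k) \<otimes> one_plus R n D' (k,j) = (if j = k then D (i,k) else \<zero>)"
      using ij Dc D'c by (simp add: one_plus_def r_distr prod)
  qed (use Dc in auto)
  also have "\<dots> = D (i,j)" using Dc ij by (intro add.finprod_singleton) simp_all
  finally have "(one_plus R n D \<otimes>\<^bsub>mat_monoid R n\<^esub> one_plus R n D') (i,j) =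
      one_plus R n D' (i,j) \<oplus> D (i,j)"
    by (simp only: mat_mult_col[OF ij] mat_vec_one_plus[OF D w ij(1)])
  then show "(one_plus R n D \<otimes>\<^bsub>mat_monoid R n\<^esub> one_plus R n D') (i,j) = \<one>\<^bsub>mat_monoid R n\<^esub> (i,j)"
    using ij Dc[of j] D'c[of i] sum[OF ij]
    by (simp add: one_plus_def a_assoc a_comm[of "D' (i,j)"])
qed

text \<open>A nonzero entry has its row outside P and its column in P. In a product D (i,k) D (k,j)
  the index k would have to lie both in P and outside P, so D squares to zero and 1 - D is the
  inverse of 1 + D.\<close>

lemma one_plus_GL:
  assumes D: "D \<in> {..<n} \<times> {..<n} \<rightarrow> carrier R"
    and block: "\<And>i j. i < n \<Longrightarrow> j < n \<Longrightarrow> i \<in> P \<or> j \<notin> P \<Longrightarrow> D (i,j) = \<zero>"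
  shows "one_plus R n D \<in> GL n R"
proof -
  let ?D = "\<lambda>p. \<ominus> D p"
  have Dc: "D (i,j) \<in> carrier R" if "i < n" "j < n" for i j
    using D that by auto
  have D': "?D \<in> {..<n} \<times> {..<n} \<rightarrow> carrier R" using D by auto
  have 0: "D (i,k) = \<zero> \<or> D (k,j) = \<zero>" if "i < n" "j < n" "k < n" for i j k
    using block that by blast
  have "D (i,k) \<otimes> \<ominus> D (k,j) = \<zero>" "\<ominus> D (i,k) \<otimes> D (k,j) = \<zero>" if "i < n" "j < n" "k < n" for i j k
    using 0[OF that] Dc[of i k] Dc[of k j] that by (elim disjE; simp)+
  note prod = this
  have "one_plus R n D \<otimes>\<^bsub>mat_monoid R n\<^esub> one_plus R n ?D = \<one>\<^bsub>mat_monoid R n\<^esub>"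
    by (rule one_plus_mult[OF D D']) (simp_all add: Dc prod r_neg)
  moreover have "one_plus R n ?D \<otimes>\<^bsub>mat_monoid R n\<^esub> one_plus R n D = \<one>\<^bsub>mat_monoid R n\<^esub>"
    by (rule one_plus_mult[OF D' D]) (simp_all add: Dc prod l_neg)
  ultimately show ?thesis
    using one_plus_closed[OF D] one_plus_closed[OF D']
    unfolding GL_def Units_def mat_monoid_simps(1) by blast
qed

lemma GL_mult: "A \<in> GL n R \<Longrightarrow> B \<in> GL n R \<Longrightarrow> A \<otimes>\<^bsub>mat_monoid R n\<^esub> B \<in> GL n R"
  unfolding GL_def by (rule monoid.Units_m_closed[OF monoid_mat_monoid])

lemma GL_closed: "A \<in> GL n R \<Longrightarrow> A \<in> {..<n} \<times> {..<n} \<rightarrow>\<^sub>E carrier R"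
  unfolding GL_def Units_def mat_monoid_simps(1) by blast

end

context module
begin

lemma lin_comb_one_plus:
  assumes x: "x \<in> {..<n} \<rightarrow> carrier M" and D: "D \<in> {..<n} \<times> {..<n} \<rightarrow> carrier R"
    and w: "w \<in> {..<n} \<rightarrow> carrier R"
  shows "lin_comb M n x (mat_vec R n (one_plus R n D) w) =
     lin_comb M n x w \<oplus>\<^bsub>M\<^esub> lin_comb M n (\<lambda>j. lin_comb M n x (\<lambda>i. D (i,j))) w"
proof -
  have c: "mat_vec R n D w \<in> {..<n} \<rightarrow> carrier R"
    by (rule PiE_funcset[OF R.mat_vec_closed[OF D w]])
  have "mat_vec R n (one_plus R n D) w = (\<lambda>i\<in>{..<n}. w i \<oplus> mat_vec R n D w i)"
    using R.mat_vec_one_plus[OF D w] by (auto simp: fun_eq_iff) (simp add: mat_vec_def)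
  then show ?thesis
    by (simp add: lin_comb_add[OF x w c] lin_comb_mat_vec[OF x D w])
qed

text \<open>Start from any coefficients of the y j in terms of x. Entries in rows of P may be erased
  because x vanishes there, and columns outside P may be erased because there y j = 0 is to be
  represented.\<close>

lemma block_matrix:
  assumes x: "x \<in> {..<n} \<rightarrow> carrier M" and y: "y \<in> {..<n} \<rightarrow> carrier M"
    and x0: "\<And>i. i < n \<Longrightarrow> i \<in> P \<Longrightarrow> x i = \<zero>\<^bsub>M\<^esub>"
    and y0: "\<And>i. i < n \<Longrightarrow> i \<notin> P \<Longrightarrow> y i = \<zero>\<^bsub>M\<^esub>"
    and span: "carrier M \<subseteq> lin_comb M n x ` ({..<n} \<rightarrow>\<^sub>E carrier R)"
  obtains D where "D \<in> {..<n} \<times> {..<n} \<rightarrow> carrier R"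
    and "\<And>i j. i < n \<Longrightarrow> j < n \<Longrightarrow> i \<in> P \<or> j \<notin> P \<Longrightarrow> D (i,j) = \<zero>"
    and "\<And>j. j < n \<Longrightarrow> lin_comb M n x (\<lambda>i. D (i,j)) = y j"
proof -
  have "\<exists>c. \<forall>j<n. c j \<in> {..<n} \<rightarrow> carrier R \<and> lin_comb M n x (c j) = y j"
  proof -
    have "\<exists>c. c \<in> {..<n} \<rightarrow> carrier R \<and> lin_comb M n x c = y j" if "j < n" for j
    proof -
      have "y j \<in> carrier M" using y that by auto
      then obtain c where "c \<in> {..<n} \<rightarrow>\<^sub>E carrier R" "y j = lin_comb M n x c" using span by blast
      then show ?thesis by (metis PiE_funcset)
    qed
    then show ?thesis by metis
  qed
  then obtain c where c: "\<And>j. j < n \<Longrightarrow> c j \<in> {..<n} \<rightarrow> carrier R"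
    and cy: "\<And>j. j < n \<Longrightarrow> lin_comb M n x (c j) = y j" by blast
  have cc: "c j i \<in> carrier R" if "i < n" "j < n" for i j using c that by auto
  define D where "D = (\<lambda>(i,j). if i \<notin> P \<and> j \<in> P then c j i else \<zero>)"
  show thesis
  proof
    show "D \<in> {..<n} \<times> {..<n} \<rightarrow> carrier R" using cc by (auto simp: D_def)
    show "D (i,j) = \<zero>" if "i \<in> P \<or> j \<notin> P" for i j using that by (auto simp: D_def)
    show "lin_comb M n x (\<lambda>i. D (i,j)) = y j" if j: "j < n" for j
    proof (cases "j \<in> P")
      case True
      have "lin_comb M n x (\<lambda>i. D (i,j)) = lin_comb M n x (c j)"
        using j True x x0 cc by (intro lin_comb_cong c) (auto simp: D_def)
      then show ?thesis using cy[OF j] by simp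
    next
      case False
      have "lin_comb M n x (\<lambda>i. D (i,j)) = (\<Oplus>\<^bsub>M\<^esub>i\<in>{..<n}. \<zero>\<^bsub>M\<^esub>)"
        unfolding lin_comb_def using x False by (intro M.finsum_cong') (auto simp: D_def Pi_iff)
      then show ?thesis using y0[OF j False] by (simp add: M.finsum_zero)
    qed
  qed
qed

text \<open>The equation x = y A is stated on coefficient vectors w, the form in which it enters the
  commuting square of the two triples.\<close>

lemma lin_comb_GL:
  assumes x: "x \<in> {..<n} \<rightarrow> carrier M" and y: "y \<in> {..<n} \<rightarrow> carrier M"
    and x0: "\<And>i. i < n \<Longrightarrow> i \<in> P \<Longrightarrow> x i = \<zero>\<^bsub>M\<^esub>"
    and y0: "\<And>i. i < n \<Longrightarrow> i \<notin> P \<Longrightarrow> y i = \<zero>\<^bsub>M\<^esub>"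
    and span_x: "carrier M \<subseteq> lin_comb M n x ` ({..<n} \<rightarrow>\<^sub>E carrier R)"
    and span_y: "carrier M \<subseteq> lin_comb M n y ` ({..<n} \<rightarrow>\<^sub>E carrier R)"
  obtains A where "A \<in> GL n R"
    and "\<And>w. w \<in> {..<n} \<rightarrow> carrier R \<Longrightarrow> lin_comb M n y (mat_vec R n A w) = lin_comb M n x w"
proof -
  obtain B where B: "B \<in> {..<n} \<times> {..<n} \<rightarrow> carrier R"
    and B0: "\<And>i j. i < n \<Longrightarrow> j < n \<Longrightarrow> i \<in> P \<or> j \<notin> P \<Longrightarrow> B (i,j) = \<zero>"
    and By: "\<And>j. j < n \<Longrightarrow> lin_comb M n x (\<lambda>i. B (i,j)) = y j"
    using block_matrix[OF x y x0 y0 span_x] by blast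
  \<comment> \<open>With x and y exchanged the complement of P takes over: the entries of C live in
    rows of P and columns outside P.\<close>
  obtain C where C: "C \<in> {..<n} \<times> {..<n} \<rightarrow> carrier R"
    and C0: "\<And>i j. i < n \<Longrightarrow> j < n \<Longrightarrow> i \<in> - P \<or> j \<notin> - P \<Longrightarrow> C (i,j) = \<zero>"
    and Cx: "\<And>j. j < n \<Longrightarrow> lin_comb M n y (\<lambda>i. C (i,j)) = x j"
    by (rule block_matrix[OF y x, of "- P"]) (use x0 y0 span_y in auto)
  \<comment> \<open>Then \<open>one_plus R n B'\<close> is the matrix 1 - B.\<close>
  define B' where "B' = (\<lambda>p. \<ominus> B p)"
  have B': "B' \<in> {..<n} \<times> {..<n} \<rightarrow> carrier R" using B by (auto simp: B'_def)
  have Bc: "B (i,j) \<in> carrier R" if "i < n" "j < n" for i j using B that by auto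
  have xc: "x i \<in> carrier M" and yc: "y i \<in> carrier M" if "i < n" for i using x y that by auto
  show thesis
  proof
    have GC: "one_plus R n C \<in> GL n R"
      by (rule R.one_plus_GL[OF C C0])
    have GB: "one_plus R n B' \<in> GL n R"
      by (rule R.one_plus_GL[OF B', of P]) (use B0 in \<open>simp add: B'_def\<close>)
    show "one_plus R n C \<otimes>\<^bsub>mat_monoid R n\<^esub> one_plus R n B' \<in> GL n R"
      by (rule R.GL_mult[OF GC GB])
    fix w assume w: "w \<in> {..<n} \<rightarrow> carrier R"
    have wc: "w i \<in> carrier R" if "i < n" for i using w that by auto
    define v where "v = mat_vec R n (one_plus R n B') w"
    have v: "v \<in> {..<n} \<rightarrow> carrier R"
      unfolding v_def by (intro PiE_funcset[OF R.mat_vec_closed] PiE_funcset[OF R.one_plus_closed] B' w)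
    have xB: "lin_comb M n x (\<lambda>i. B' (i,j)) = \<ominus>\<^bsub>M\<^esub> y j" if j: "j < n" for j
    proof -
      \<comment> \<open>The sign is written as the scalar -1 so that it can be pulled out by
        linearity in the coefficients.\<close>
      have "lin_comb M n x (\<lambda>i. B' (i,j)) = lin_comb M n x (\<lambda>i\<in>{..<n}. \<ominus> \<one> \<otimes> B (i,j))"
        using x Bc j by (intro lin_comb_cong) (auto simp: B'_def R.l_minus)
      also have "\<dots> = \<ominus> \<one> \<odot>\<^bsub>M\<^esub> y j"
        using By[OF j] Bc j by (subst lin_comb_smult[OF x]) auto
      finally show ?thesis using yc[OF j] by (simp add: smult_l_minus)
    qed
    \<comment> \<open>The nonzero entries of B lie in rows outside P, where y vanishes. So y B = 0,
      and the factor 1 - B leaves y unchanged.\<close>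
    have yB: "lin_comb M n y (\<lambda>i. B' (i,j)) = \<zero>\<^bsub>M\<^esub>" if j: "j < n" for j
    proof -
      have "B' (i,j) \<odot>\<^bsub>M\<^esub> y i = \<zero>\<^bsub>M\<^esub>" if "i < n" for i
        using that j B0[OF that j] Bc[OF that j] y0[OF that] yc[OF that]
        by (cases "i \<in> P") (auto simp: B'_def)
      then have "lin_comb M n y (\<lambda>i. B' (i,j)) = (\<Oplus>\<^bsub>M\<^esub>i\<in>{..<n}. \<zero>\<^bsub>M\<^esub>)"
        unfolding lin_comb_def by (intro M.finsum_cong') auto
      then show ?thesis by (simp add: M.finsum_zero)
    qed
    have xv: "lin_comb M n x v = lin_comb M n x w \<oplus>\<^bsub>M\<^esub> \<ominus>\<^bsub>M\<^esub> lin_comb M n y w"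
    proof -
      have "lin_comb M n (\<lambda>j. lin_comb M n x (\<lambda>i. B' (i,j))) w =
          lin_comb M n y (\<lambda>i\<in>{..<n}. \<ominus> \<one> \<otimes> w i)"
        using y wc xB by (intro lin_comb_cong) (auto simp: smult_r_minus smult_l_minus R.l_minus Pi_iff)
      also have "\<dots> = \<ominus>\<^bsub>M\<^esub> lin_comb M n y w"
        by (subst lin_comb_smult[OF y _ w]) (simp_all add: smult_l_minus lin_comb_closed[OF y w])
      finally show ?thesis
        unfolding v_def lin_comb_one_plus[OF x B' w] by simp
    qed
    have yv: "lin_comb M n y v = lin_comb M n y w"
    proof -
      have "lin_comb M n (\<lambda>j. lin_comb M n y (\<lambda>i. B' (i,j))) w = (\<Oplus>\<^bsub>M\<^esub>i\<in>{..<n}. \<zero>\<^bsub>M\<^esub>)"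
        unfolding lin_comb_def[of M n _ w] using wc by (intro M.finsum_cong') (auto simp: yB)
      then show ?thesis
        unfolding v_def lin_comb_one_plus[OF y B' w]
        by (simp add: M.finsum_zero lin_comb_closed[OF y w])
    qed
    have "lin_comb M n y (mat_vec R n (one_plus R n C \<otimes>\<^bsub>mat_monoid R n\<^esub> one_plus R n B') w) =
        lin_comb M n y (mat_vec R n (one_plus R n C) v)"
      unfolding v_def
      by (subst R.mat_vec_mult[OF PiE_funcset[OF R.one_plus_closed[OF C]] PiE_funcset[OF R.one_plus_closed[OF B']] w]) simp
    also have "\<dots> = lin_comb M n y v \<oplus>\<^bsub>M\<^esub> lin_comb M n (\<lambda>j. lin_comb M n y (\<lambda>i. C (i,j))) v"
      by (rule lin_comb_one_plus[OF y C v])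
    also have "lin_comb M n (\<lambda>j. lin_comb M n y (\<lambda>i. C (i,j))) v = lin_comb M n x v"
      using x v Cx by (intro lin_comb_cong) auto
    \<comment> \<open>Here y v = y w and x v = x w - y w, so the terms y w cancel.\<close>
    also have "lin_comb M n y v \<oplus>\<^bsub>M\<^esub> lin_comb M n x v = lin_comb M n x w"
      unfolding xv yv using lin_comb_closed[OF x w] lin_comb_closed[OF y w]
      by (simp add: M.a_lcomm[of "lin_comb M n y w"] M.r_neg)
    finally show "lin_comb M n y (mat_vec R n (one_plus R n C \<otimes>\<^bsub>mat_monoid R n\<^esub> one_plus R n B') w) =
        lin_comb M n x w" .
  qed
qed

end

section \<open>Extension of scalars\<close>

locale scalar_extension = M: module R M + S: cring S
  for R :: "('a,'r) ring_scheme" and S :: "('s,'t) ring_scheme" and h :: "'a \<Rightarrow> 's"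
    and M :: "('a,'m,'p) module_scheme" +
  assumes h: "h \<in> ring_hom R S"
begin

sublocale tensor_product R M "ring_as_module S h"
  by (intro tensor_product.intro M.module_axioms module_ring_as_module M.is_cring S.is_cring h)

abbreviation "B \<equiv> base_change R h S M"

lemma base_change_simps [simp]:
  "carrier B = carrier T" "\<zero>\<^bsub>B\<^esub> = \<zero>\<^bsub>T\<^esub>" "X \<oplus>\<^bsub>B\<^esub> Y = X \<oplus>\<^bsub>T\<^esub> Y"
  by (simp_all add: base_change_def tensor_with_smult_def)

text \<open>The base change and the bare tensor group are different records with the same carrier
  and addition; this moves additivity between them.\<close>

lemma additive_base_change_iff:
  "additive B P f \<longleftrightarrow> additive T P f" "additive P' B g \<longleftrightarrow> additive P' T g"
  by (simp_all add: additive_def)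

text \<open>This makes the scalar operation of \<open>base_change\<close> well defined. Balancedness
  over R comes from commutativity of S, which moves s past h r.\<close>

lemma balanced_smult:
  assumes s: "s \<in> carrier S"
  shows "balanced R M (ring_as_module S h) T (\<lambda>x t. pure x (s \<otimes>\<^bsub>S\<^esub> t))"
  unfolding balanced_def
proof (intro conjI ballI additiveI; simp)
  fix r x t assume *: "r \<in> carrier R" "x \<in> carrier M" "t \<in> carrier S"
  then have "pure (r \<odot>\<^bsub>M\<^esub> x) (s \<otimes>\<^bsub>S\<^esub> t) = pure x (h r \<otimes>\<^bsub>S\<^esub> (s \<otimes>\<^bsub>S\<^esub> t))"
    using s pure_smult[of r x "s \<otimes>\<^bsub>S\<^esub> t"] by simp
  then show "pure (r \<odot>\<^bsub>M\<^esub> x) (s \<otimes>\<^bsub>S\<^esub> t) = pure x (s \<otimes>\<^bsub>S\<^esub> (h r \<otimes>\<^bsub>S\<^esub> t))"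
    using s * ring_hom_closed[OF h] by (simp add: S.m_lcomm)
qed (use s in \<open>simp_all add: pure_add_left pure_add_right[simplified] S.r_distr\<close>)

lemma smult_eq: "s \<odot>\<^bsub>B\<^esub> X = tensor_lift T (\<lambda>x t. pure x (s \<otimes>\<^bsub>S\<^esub> t)) X"
  by (simp add: base_change_def tensor_with_smult_def)

lemma smult_pure:
  assumes "s \<in> carrier S" "x \<in> carrier M" "t \<in> carrier S"
  shows "s \<odot>\<^bsub>B\<^esub> pure x t = pure x (s \<otimes>\<^bsub>S\<^esub> t)"
  using assms by (simp add: smult_eq tensor_lift_pure[OF T.abelian_group_axioms balanced_smult])

lemma smult_additive:
  assumes "s \<in> carrier S"
  shows "additive T T (\<lambda>X. s \<odot>\<^bsub>B\<^esub> X)"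
  unfolding smult_eq by (rule tensor_lift_additive[OF T.abelian_group_axioms balanced_smult[OF assms]])

lemma additive_id: "additive T T (\<lambda>X. X)"
  by (auto intro: additiveI)

text \<open>The axioms mixing scalars are equalities between maps additive in X, hence can be read
  off on pure tensors, where they become ring laws of S in the second factor.\<close>

lemma module_base_change: "module S B"
proof (rule moduleI)
  show "abelian_group B"
    by (rule abelian_groupI)
       (use T.l_neg in \<open>auto simp: T.a_ac intro: bexI[of _ "\<ominus>\<^bsub>T\<^esub> x" for x]\<close>)
next
  fix s X assume "s \<in> carrier S" "X \<in> carrier B"
  then show "s \<odot>\<^bsub>B\<^esub> X \<in> carrier B"
    using additive_closed[OF smult_additive] by simp
next
  fix s t X assume st: "s \<in> carrier S" "t \<in> carrier S" and X: "X \<in> carrier B"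
  have sum: "additive T T (\<lambda>X. s \<odot>\<^bsub>B\<^esub> X \<oplus>\<^bsub>T\<^esub> t \<odot>\<^bsub>B\<^esub> X)"
    by (rule additiveI)
       (simp_all add: st additive_closed[OF smult_additive] additive_add[OF smult_additive] T.a_ac)
  have "(s \<oplus>\<^bsub>S\<^esub> t) \<odot>\<^bsub>B\<^esub> X = s \<odot>\<^bsub>B\<^esub> X \<oplus>\<^bsub>T\<^esub> t \<odot>\<^bsub>B\<^esub> X"
    by (rule tensor_hom_eq[OF T.abelian_group_axioms smult_additive sum])
       (use st X in \<open>simp_all add: smult_pure S.l_distr pure_add_right[simplified]\<close>)
  then show "(s \<oplus>\<^bsub>S\<^esub> t) \<odot>\<^bsub>B\<^esub> X = s \<odot>\<^bsub>B\<^esub> X \<oplus>\<^bsub>B\<^esub> t \<odot>\<^bsub>B\<^esub> X" by simp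
  show "(s \<otimes>\<^bsub>S\<^esub> t) \<odot>\<^bsub>B\<^esub> X = s \<odot>\<^bsub>B\<^esub> (t \<odot>\<^bsub>B\<^esub> X)"
    by (rule tensor_hom_eq[OF T.abelian_group_axioms smult_additive
          additive_comp[OF smult_additive[of t] smult_additive[of s]]])
       (use st X in \<open>simp_all add: smult_pure S.m_assoc\<close>)
next
  fix s X Y assume "s \<in> carrier S" "X \<in> carrier B" "Y \<in> carrier B"
  then show "s \<odot>\<^bsub>B\<^esub> (X \<oplus>\<^bsub>B\<^esub> Y) = s \<odot>\<^bsub>B\<^esub> X \<oplus>\<^bsub>B\<^esub> s \<odot>\<^bsub>B\<^esub> Y"
    using additive_add[OF smult_additive] by simp
next
  fix X assume X: "X \<in> carrier B"
  show "\<one>\<^bsub>S\<^esub> \<odot>\<^bsub>B\<^esub> X = X"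
    by (rule tensor_hom_eq[OF T.abelian_group_axioms smult_additive additive_id])
       (use X in \<open>simp_all add: smult_pure\<close>)
qed (rule S.is_cring)

sublocale B: module S B
  by (rule module_base_change)

text \<open>Scalars from R move across the tensor sign and become scalars from S. The coefficients
  on the right are the coordinates that \<open>free_base_change\<close> assigns to v \<otimes>
  s.\<close>

lemma lin_comb_base_change:
  assumes x: "x \<in> {..<n} \<rightarrow> carrier M" and v: "v \<in> {..<n} \<rightarrow> carrier R" and s: "s \<in> carrier S"
  shows "pure (lin_comb M n x v) s = lin_comb B n (\<lambda>j. pure (x j) \<one>\<^bsub>S\<^esub>) (\<lambda>j\<in>{..<n}. h (v j) \<otimes>\<^bsub>S\<^esub> s)"
proof -
  have *: "x j \<in> carrier M" "v j \<in> carrier R" "h (v j) \<in> carrier S" if "j < n" for j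
    using that x v ring_hom_closed[OF h] by auto
  have "additive M B (\<lambda>y. pure y s)"
    using s by (intro additiveI) (simp_all add: pure_add_left)
  then have "pure (lin_comb M n x v) s = (\<Oplus>\<^bsub>B\<^esub>j\<in>{..<n}. pure (v j \<odot>\<^bsub>M\<^esub> x j) s)"
    unfolding lin_comb_def using *
    by (intro additive_finsum[OF M.abelian_group_axioms B.abelian_group_axioms]) auto
  also have "\<dots> = (\<Oplus>\<^bsub>B\<^esub>j\<in>{..<n}. (\<lambda>j\<in>{..<n}. h (v j) \<otimes>\<^bsub>S\<^esub> s) j \<odot>\<^bsub>B\<^esub> pure (x j) \<one>\<^bsub>S\<^esub>)"
    using s * by (intro B.finsum_cong') (auto simp: pure_smult smult_pure)
  finally show ?thesis by (simp add: lin_comb_def)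
qed

text \<open>The set of combinations is the image of an additive map, hence contains zero and is
  closed under differences. It remains to reach pure tensors y \<otimes> s, by expanding y in the
  given generators.\<close>

lemma base_change_span:
  assumes x: "x \<in> {..<n} \<rightarrow> carrier M"
    and span: "carrier M \<subseteq> lin_comb M n x ` ({..<n} \<rightarrow>\<^sub>E carrier R)"
  shows "carrier B \<subseteq> lin_comb B n (\<lambda>j. pure (x j) \<one>\<^bsub>S\<^esub>) ` ({..<n} \<rightarrow>\<^sub>E carrier S)"
    (is "_ \<subseteq> ?L ` _")
proof
  have u: "(\<lambda>j. pure (x j) \<one>\<^bsub>S\<^esub>) \<in> {..<n} \<rightarrow> carrier B" using x by auto
  interpret W: module S "free_module S n" by (rule S.module_free_module)
  have L: "additive (free_module S n) B ?L"
    using B.lin_comb_hom[OF u] by (auto simp: mod_homs_def additive_def)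
  fix X assume "X \<in> carrier B"
  then have "X \<in> carrier T" by simp
  then have "X \<in> ?L ` carrier (free_module S n)"
  proof (induction X rule: tensor_induct)
    case zero
    then show ?case
      using additive_zero[OF W.abelian_group_axioms B.abelian_group_axioms L, symmetric] W.zero_closed
      by (simp only: base_change_simps(2) image_eqI)
  next
    case (diff X Y)
    then obtain v w where v: "v \<in> carrier (free_module S n)" "X = ?L v"
      and w: "w \<in> carrier (free_module S n)" "Y = ?L w" by blast
    have "X \<ominus>\<^bsub>B\<^esub> Y = ?L (v \<ominus>\<^bsub>free_module S n\<^esub> w)"
      unfolding v(2) w(2)
      by (rule additive_minus[OF W.abelian_group_axioms B.abelian_group_axioms L v(1) w(1), symmetric])
    moreover have "v \<ominus>\<^bsub>free_module S n\<^esub> w \<in> carrier (free_module S n)"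
      by (rule W.minus_closed[OF v(1) w(1)])
    \<comment> \<open>Subtraction is defined from the whole record, so it has to be transferred; the
      identity is an additive map from one record to the other.\<close>
    moreover have "X \<ominus>\<^bsub>B\<^esub> Y = X \<ominus>\<^bsub>T\<^esub> Y"
      using diff additive_minus[OF B.abelian_group_axioms T.abelian_group_axioms, of "\<lambda>X. X" X Y]
        additive_id by (simp add: additive_base_change_iff)
    ultimately show ?case by (simp only: image_eqI)
  next
    case (pure y s)
    obtain v where v: "v \<in> {..<n} \<rightarrow>\<^sub>E carrier R" "y = lin_comb M n x v"
      using span pure(1) by blast
    have s: "s \<in> carrier S" using pure by simp
    have "(\<lambda>j\<in>{..<n}. h (v j) \<otimes>\<^bsub>S\<^esub> s) \<in> carrier (free_module S n)"
      using v(1) s ring_hom_closed[OF h] by (simp add: PiE_iff)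
    moreover note lin_comb_base_change[OF x PiE_funcset[OF v(1)] s, folded v(2)]
    ultimately show ?case by (intro image_eqI)
  qed
  then show "X \<in> ?L ` ({..<n} \<rightarrow>\<^sub>E carrier S)" by simp
qed

end

lemma base_change_map:
  assumes "scalar_extension R S h M" "scalar_extension R S h M'" and f: "f \<in> mod_homs R M M'"
  shows base_change_map_additive: "additive (tensor_grp R M (ring_as_module S h)) (tensor_grp R M' (ring_as_module S h))
      (base_change_map R h S M' f)"
    and base_change_map_pure: "x \<in> carrier M \<Longrightarrow> s \<in> carrier S \<Longrightarrow>
      base_change_map R h S M' f (pure_tensor R M (ring_as_module S h) x s) =
      pure_tensor R M' (ring_as_module S h) (f x) s"
proof -
  interpret A: scalar_extension R S h M by fact
  interpret C: scalar_extension R S h M' by fact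
  have f': "f x \<in> carrier M'" if "x \<in> carrier M" for x using f that by (auto simp: mod_homs_def)
  have bal: "balanced R M (ring_as_module S h) C.T (\<lambda>x s. C.pure (f x) s)"
    unfolding balanced_def
    by (intro conjI ballI additiveI; insert f; simp add: mod_homs_def f' C.pure_add_left C.pure_add_right[simplified] C.pure_smult[simplified])
  show "additive A.T C.T (base_change_map R h S M' f)"
    unfolding tensor_map_id_def by (rule A.tensor_lift_additive[OF C.T.abelian_group_axioms bal])
  show "base_change_map R h S M' f (A.pure x s) = C.pure (f x) s" if "x \<in> carrier M" "s \<in> carrier S"
    unfolding tensor_map_id_def using that
    by (intro A.tensor_lift_pure[OF C.T.abelian_group_axioms bal]) simp_all
qed

section \<open>Scalar extension of free modules\<close>

context
  fixes R :: "('a,'r) ring_scheme" and S :: "('s,'t) ring_scheme" and h :: "'a \<Rightarrow> 's" and n :: nat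
  assumes R: "cring R" and S: "cring S" and h: "h \<in> ring_hom R S"
begin

interpretation R: cring R by (rule R)
interpretation S: cring S by (rule S)
interpretation A: scalar_extension R S h "free_module R n"
  by (intro scalar_extension.intro scalar_extension_axioms.intro R.module_free_module S h)
interpretation W: module S "free_module S n" by (rule S.module_free_module)

lemma scalar_extension_free: "scalar_extension R S h (free_module R n)"
  by (rule A.scalar_extension_axioms)

lemma balanced_free:
  "balanced R (free_module R n) (ring_as_module S h) (free_module S n) (\<lambda>v s. \<lambda>i\<in>{..<n}. h (v i) \<otimes>\<^bsub>S\<^esub> s)"
  unfolding balanced_def
  by (intro conjI ballI additiveI)
     (auto simp: fun_eq_iff PiE_iff ring_hom_closed[OF h] ring_hom_add[OF h] ring_hom_mult[OF h]
        S.l_distr S.r_distr S.m_ac)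

lemma free_base_change_additive: "additive A.T (free_module S n) (free_base_change h S n)"
  unfolding free_base_change_def
  by (rule A.tensor_lift_additive[OF W.abelian_group_axioms balanced_free])

lemma free_base_change_pure:
  assumes "v \<in> {..<n} \<rightarrow>\<^sub>E carrier R" "s \<in> carrier S"
  shows "free_base_change h S n (A.pure v s) = (\<lambda>i\<in>{..<n}. h (v i) \<otimes>\<^bsub>S\<^esub> s)"
  unfolding free_base_change_def using assms
  by (intro A.tensor_lift_pure[OF W.abelian_group_axioms balanced_free]) simp_all

text \<open>A lift to the tensor product is only additive by construction; linearity over S needs
  this separate comparison on pure tensors.\<close>

lemma free_base_change_smult:
  assumes s: "s \<in> carrier S" and X: "X \<in> carrier A.T"
  shows "free_base_change h S n (s \<odot>\<^bsub>A.B\<^esub> X) = s \<odot>\<^bsub>free_module S n\<^esub> free_base_change h S n X"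
proof (rule A.tensor_hom_eq[OF W.abelian_group_axioms])
  show "additive A.T (free_module S n) (\<lambda>X. free_base_change h S n (s \<odot>\<^bsub>A.B\<^esub> X))"
    by (rule additive_comp[OF A.smult_additive[OF s] free_base_change_additive])
  have "additive (free_module S n) (free_module S n) (\<lambda>w. s \<odot>\<^bsub>free_module S n\<^esub> w)"
    using s W.smult_r_distr by (intro additiveI) (blast intro: W.smult_closed)+
  then show "additive A.T (free_module S n) (\<lambda>X. s \<odot>\<^bsub>free_module S n\<^esub> free_base_change h S n X)"
    by (rule additive_comp[OF free_base_change_additive])
  fix v t assume "v \<in> carrier (free_module R n)" "t \<in> carrier (ring_as_module S h)"
  then show "free_base_change h S n (s \<odot>\<^bsub>A.B\<^esub> A.pure v t) = s \<odot>\<^bsub>free_module S n\<^esub> free_base_change h S n (A.pure v t)"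
    using s by (auto simp: A.smult_pure free_base_change_pure fun_eq_iff PiE_iff ring_hom_closed[OF h] S.m_lcomm)
qed (rule X)

abbreviation (input) "unit_vec j \<equiv> (\<lambda>i\<in>{..<n}. if i = j then \<one>\<^bsub>R\<^esub> else \<zero>\<^bsub>R\<^esub>)"

lemma unit_vec_closed: "unit_vec j \<in> {..<n} \<rightarrow>\<^sub>E carrier R"
  by auto

lemma lin_comb_unit_vec:
  assumes "v \<in> {..<n} \<rightarrow>\<^sub>E carrier R"
  shows "lin_comb (free_module R n) n unit_vec v = v"
proof (rule PiE_ext)
  have e: "unit_vec \<in> {..<n} \<rightarrow> carrier (free_module R n)" by auto
  show "lin_comb (free_module R n) n unit_vec v \<in> {..<n} \<rightarrow>\<^sub>E carrier R"
    using A.M.lin_comb_closed[OF e PiE_funcset[OF assms]] by simp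
  fix i assume i: "i \<in> {..<n}"
  have v: "v j \<in> carrier R" if "j < n" for j using assms that by auto
  \<comment> \<open>Addition in the free module is pointwise, so reading off coordinate i is
    additive and passes through the finite sum.\<close>
  have ev: "additive (free_module R n) R (\<lambda>w. w i)"
    using i by (intro additiveI) auto
  have cl: "v j \<odot>\<^bsub>free_module R n\<^esub> unit_vec j \<in> carrier (free_module R n)" if "j \<in> {..<n}" for j
    using v that by (simp add: PiE_iff)
  have "lin_comb (free_module R n) n unit_vec v i =
      (\<Oplus>\<^bsub>R\<^esub>j\<in>{..<n}. (v j \<odot>\<^bsub>free_module R n\<^esub> unit_vec j) i)"
    unfolding lin_comb_def
    by (rule additive_finsum[OF A.M.abelian_group_axioms R.abelian_group_axioms ev finite_lessThan cl])
  also have "\<dots> = (\<Oplus>\<^bsub>R\<^esub>j\<in>{..<n}. if i = j then v j else \<zero>\<^bsub>R\<^esub>)"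
    using i v by (intro R.finsum_cong') simp_all
  also have "\<dots> = v i" using i v by (intro R.add.finprod_singleton) simp_all
  finally show "lin_comb (free_module R n) n unit_vec v i = v i" .
qed (rule assms)

text \<open>The inverse sends w to the combination of the e_j \<otimes> 1 with coefficients w, where
  e_j are the unit vectors. One composite is compared with the identity on pure tensors, the other
  one coordinate by coordinate.\<close>

lemma free_base_change_bij:
  "bij_betw (free_base_change h S n) (carrier A.T) ({..<n} \<rightarrow>\<^sub>E carrier S)"
proof -
  let ?e = "\<lambda>j. A.pure (unit_vec j) \<one>\<^bsub>S\<^esub>" and ?f = "free_base_change h S n"
  have e: "?e \<in> {..<n} \<rightarrow> carrier A.B" using unit_vec_closed by auto
  have g: "additive (free_module S n) A.T (lin_comb A.B n ?e)"
    using A.B.lin_comb_hom[OF e] by (auto simp: mod_homs_def additive_def)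
  have left: "lin_comb A.B n ?e (?f X) = X" if "X \<in> carrier A.T" for X
  proof (rule A.tensor_hom_eq[OF A.T.abelian_group_axioms _ A.additive_id _ that])
    show "additive A.T A.T (\<lambda>X. lin_comb A.B n ?e (?f X))"
      by (rule additive_comp[OF free_base_change_additive g])
    fix v s assume "v \<in> carrier (free_module R n)" "s \<in> carrier (ring_as_module S h)"
    then have v: "v \<in> {..<n} \<rightarrow>\<^sub>E carrier R" and s: "s \<in> carrier S" by simp_all
    have "unit_vec \<in> {..<n} \<rightarrow> carrier (free_module R n)" by auto
    note A.lin_comb_base_change[OF this PiE_funcset[OF v] s, unfolded lin_comb_unit_vec[OF v]]
    then show "lin_comb A.B n ?e (?f (A.pure v s)) = A.pure v s"
      unfolding free_base_change_pure[OF v s] by (rule sym)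
  qed
  have right: "?f (lin_comb A.B n ?e w) = w" if w: "w \<in> {..<n} \<rightarrow>\<^sub>E carrier S" for w
  proof (rule PiE_ext[OF _ w])
    have c: "lin_comb A.B n ?e w \<in> carrier A.T"
      using A.B.lin_comb_closed[OF e PiE_funcset[OF w]] by simp
    show "?f (lin_comb A.B n ?e w) \<in> {..<n} \<rightarrow>\<^sub>E carrier S"
      using additive_closed[OF free_base_change_additive c] by simp
    fix i assume i: "i \<in> {..<n}"
    have w': "w j \<in> carrier S" if "j < n" for j using w that by auto
    have "additive A.B (free_module S n) ?f"
      using free_base_change_additive by (simp add: A.additive_base_change_iff)
    moreover have "additive (free_module S n) S (\<lambda>w. w i)"
      using i by (intro additiveI) auto
    ultimately have ev: "additive A.B S (\<lambda>X. ?f X i)"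
      by (rule additive_comp)
    have cl: "w j \<odot>\<^bsub>A.B\<^esub> ?e j \<in> carrier A.B" if "j \<in> {..<n}" for j
      using w' e that by (intro A.B.smult_closed) auto
    have "?f (lin_comb A.B n ?e w) i = (\<Oplus>\<^bsub>S\<^esub>j\<in>{..<n}. ?f (w j \<odot>\<^bsub>A.B\<^esub> ?e j) i)"
      unfolding lin_comb_def
      by (rule additive_finsum[OF A.B.abelian_group_axioms S.abelian_group_axioms ev finite_lessThan cl])
    also have "\<dots> = (\<Oplus>\<^bsub>S\<^esub>j\<in>{..<n}. if i = j then w j else \<zero>\<^bsub>S\<^esub>)"
    proof (rule S.finsum_cong')
      fix j assume j: "j \<in> {..<n}"
      have "w j \<odot>\<^bsub>A.B\<^esub> ?e j = A.pure (unit_vec j) (w j)"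
        using w' j unit_vec_closed[of j] by (simp add: A.smult_pure)
      then show "?f (w j \<odot>\<^bsub>A.B\<^esub> ?e j) i = (if i = j then w j else \<zero>\<^bsub>S\<^esub>)"
        using i j w' by (simp add: free_base_change_pure[OF unit_vec_closed]
            ring_hom_one[OF h] ring_hom_zero[OF h R.ring_axioms S.ring_axioms])
    qed (use w' in auto)
    also have "\<dots> = w i" using i w' by (intro S.add.finprod_singleton) simp_all
    finally show "?f (lin_comb A.B n ?e w) i = w i" .
  qed
  show ?thesis
    by (rule bij_betw_byWitness[where f' = "lin_comb A.B n ?e"])
       (use left right additive_closed[OF free_base_change_additive] additive_closed[OF g]
         in \<open>simp_all add: image_subset_iff\<close>)
qed

end

section \<open>Linear maps and generating families\<close>

lemma mod_homs_closed: "f \<in> mod_homs R M N \<Longrightarrow> x \<in> carrier M \<Longrightarrow> f x \<in> carrier N"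
  by (auto simp: mod_homs_def)

lemma mod_homs_additive: "f \<in> mod_homs R M N \<Longrightarrow> additive M N f"
  by (auto simp: mod_homs_def additive_def)

lemma mod_homs_smult:
  "f \<in> mod_homs R M N \<Longrightarrow> r \<in> carrier R \<Longrightarrow> x \<in> carrier M \<Longrightarrow> f (r \<odot>\<^bsub>M\<^esub> x) = r \<odot>\<^bsub>N\<^esub> f x"
  by (auto simp: mod_homs_def)

lemma mod_isos_comp:
  assumes "f \<in> mod_isos R M N" "g \<in> mod_isos R N P"
  shows "(\<lambda>x. g (f x)) \<in> mod_isos R M P"
proof -
  have "bij_betw (g \<circ> f) (carrier M) (carrier P)"
    using assms by (auto simp: mod_isos_def intro: bij_betw_trans)
  then show ?thesis
    using assms by (auto simp: mod_isos_def mod_homs_def Pi_iff comp_def)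
qed

text \<open>Linearity of the inverse follows from that of f by cancelling f; closure of M under its
  operations ensures that the candidate preimages lie in the carrier.\<close>

lemma mod_isos_inv:
  assumes "module R M" and f: "f \<in> mod_isos R M N"
  shows "inv_into (carrier M) f \<in> mod_isos R N M"
proof -
  interpret M: module R M by fact
  let ?g = "inv_into (carrier M) f"
  have hom: "f \<in> mod_homs R M N" and bij: "bij_betw f (carrier M) (carrier N)"
    using f by (auto simp: mod_isos_def)
  have g: "?g y \<in> carrier M" "f (?g y) = y" if "y \<in> carrier N" for y
    using that bij by (auto simp: bij_betw_def intro: inv_into_into f_inv_into_f)
  have gf: "?g (f x) = x" if "x \<in> carrier M" for x
    using that bij by (auto simp: bij_betw_def)
  have "?g (y \<oplus>\<^bsub>N\<^esub> z) = ?g y \<oplus>\<^bsub>M\<^esub> ?g z" if "y \<in> carrier N" "z \<in> carrier N" for y z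
    using gf[of "?g y \<oplus>\<^bsub>M\<^esub> ?g z"] additive_add[OF mod_homs_additive[OF hom], of "?g y" "?g z"] g that
    by simp
  moreover have "?g (r \<odot>\<^bsub>N\<^esub> y) = r \<odot>\<^bsub>M\<^esub> ?g y" if "r \<in> carrier R" "y \<in> carrier N" for r y
    using gf[of "r \<odot>\<^bsub>M\<^esub> ?g y"] mod_homs_smult[OF hom, of r "?g y"] g that by simp
  ultimately show ?thesis
    using g(1) bij_betw_inv_into[OF bij] by (auto simp: mod_isos_def mod_homs_def)
qed

lemma lin_comb_map:
  assumes "module R M" "module R N" and f: "f \<in> mod_homs R M N"
    and x: "x \<in> {..<n} \<rightarrow> carrier M" and w: "w \<in> {..<n} \<rightarrow> carrier R"
  shows "f (lin_comb M n x w) = lin_comb N n (\<lambda>i. f (x i)) w"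
proof -
  interpret M: module R M by fact
  interpret N: module R N by fact
  have c: "w i \<in> carrier R" "x i \<in> carrier M" if "i \<in> {..<n}" for i using x w that by auto
  have "f (lin_comb M n x w) = (\<Oplus>\<^bsub>N\<^esub>i\<in>{..<n}. f (w i \<odot>\<^bsub>M\<^esub> x i))"
    unfolding lin_comb_def using c
    by (intro additive_finsum[OF M.abelian_group_axioms N.abelian_group_axioms mod_homs_additive[OF f]]) auto
  also have "\<dots> = lin_comb N n (\<lambda>i. f (x i)) w"
    unfolding lin_comb_def using c mod_homs_smult[OF f] mod_homs_closed[OF f]
    by (intro N.finsum_cong') auto
  finally show ?thesis .
qed

text \<open>Passes from a finite generating set to a padded family. The index set I is left free so
  that two families can be placed at disjoint positions.\<close>

lemma (in module) lin_comb_span: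
  assumes A: "A \<subseteq> carrier M"
    and gen: "\<forall>x\<in>carrier M. \<exists>c\<in>A \<rightarrow> carrier R. x = (\<Oplus>\<^bsub>M\<^esub>a\<in>A. c a \<odot>\<^bsub>M\<^esub> a)"
    and g: "bij_betw g I A" and I: "I \<subseteq> {..<n}"
  shows "carrier M \<subseteq> lin_comb M n (\<lambda>i. if i \<in> I then g i else \<zero>\<^bsub>M\<^esub>) ` ({..<n} \<rightarrow>\<^sub>E carrier R)"
proof
  fix y assume "y \<in> carrier M"
  then obtain c where c: "c \<in> A \<rightarrow> carrier R" and y: "y = (\<Oplus>\<^bsub>M\<^esub>a\<in>A. c a \<odot>\<^bsub>M\<^esub> a)"
    using gen by blast
  have gA: "g i \<in> A" if "i \<in> I" for i using g that by (auto simp: bij_betw_def)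
  define v where "v = (\<lambda>i\<in>{..<n}. if i \<in> I then c (g i) else \<zero>)"
  have v: "v \<in> {..<n} \<rightarrow>\<^sub>E carrier R"
    using c gA by (auto simp: v_def Pi_iff)
  have "y = (\<Oplus>\<^bsub>M\<^esub>i\<in>I. c (g i) \<odot>\<^bsub>M\<^esub> g i)"
    unfolding y using g c A gA M.finsum_reindex[of "\<lambda>a. c a \<odot>\<^bsub>M\<^esub> a" g I]
    by (auto simp: bij_betw_def Pi_iff subset_iff)
  also have "\<dots> = lin_comb M n (\<lambda>i. if i \<in> I then g i else \<zero>\<^bsub>M\<^esub>) v"
    unfolding lin_comb_def
    by (rule M.add.finprod_mono_neutral_cong_left) (use I c A gA in \<open>auto simp: v_def Pi_iff subset_iff\<close>)
  finally show "y \<in> lin_comb M n (\<lambda>i. if i \<in> I then g i else \<zero>\<^bsub>M\<^esub>) ` ({..<n} \<rightarrow>\<^sub>E carrier R)"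
    using v by (rule image_eqI)
qed

lemma (in cring) mat_vec_GL_iso:
  assumes "A \<in> GL n R"
  shows "mat_vec R n A \<in> mod_isos R (free_module R n) (free_module R n)"
proof -
  have A: "A \<in> {..<n} \<times> {..<n} \<rightarrow> carrier R"
    by (rule PiE_funcset[OF GL_closed[OF assms]])
  show ?thesis
    using mat_vec_GL_bij[OF assms] mat_vec_closed[OF A PiE_funcset]
      mat_vec_add[OF A PiE_funcset PiE_funcset] mat_vec_smult[OF A _ PiE_funcset]
    by (simp add: mod_isos_def mod_homs_def)
qed

lemma free_base_change_iso:
  assumes "cring R" "cring S" "h \<in> ring_hom R S"
  shows "free_base_change h S n \<in> mod_isos S (base_change R h S (free_module R n)) (free_module S n)"
proof -
  interpret A: scalar_extension R S h "free_module R n"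
    by (rule scalar_extension_free[OF assms])
  show ?thesis
    using free_base_change_bij[OF assms, of n] free_base_change_additive[OF assms, of n]
      free_base_change_smult[OF assms, where n = n]
    unfolding mod_isos_def mod_homs_def additive_def by simp
qed

text \<open>In the coordinates of S^n, the base change of the map given by x is the map given by the
  x j \<otimes> 1. This is what turns the morphism condition into an equation between row vectors
  over S.\<close>

lemma (in scalar_extension) base_change_map_lin_comb:
  assumes x: "x \<in> {..<n} \<rightarrow> carrier M"
    and X: "X \<in> carrier (base_change R h S (free_module R n))"
  shows "base_change_map R h S M (lin_comb M n x) X =
    lin_comb B n (\<lambda>j. pure (x j) \<one>\<^bsub>S\<^esub>) (free_base_change h S n X)"
proof -
  note free = scalar_extension_free[OF M.is_cring S.is_cring h, of n]
  interpret A: scalar_extension R S h "free_module R n" by (rule free)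
  note f = M.lin_comb_hom[OF x]
  have u: "(\<lambda>j. pure (x j) \<one>\<^bsub>S\<^esub>) \<in> {..<n} \<rightarrow> carrier B" using x by auto
  show ?thesis
  proof (rule A.tensor_hom_eq[OF T.abelian_group_axioms base_change_map_additive[OF free scalar_extension_axioms f]])
    show "additive A.T T (\<lambda>X. lin_comb B n (\<lambda>j. pure (x j) \<one>\<^bsub>S\<^esub>) (free_base_change h S n X))"
      by (rule additive_comp[OF free_base_change_additive[OF M.is_cring S.is_cring h]])
         (use mod_homs_additive[OF B.lin_comb_hom[OF u]] in \<open>simp add: additive_base_change_iff\<close>)
    fix v s assume "v \<in> carrier (free_module R n)" "s \<in> carrier (ring_as_module S h)"
    then have v: "v \<in> {..<n} \<rightarrow>\<^sub>E carrier R" and s: "s \<in> carrier S" by simp_all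
    then show "base_change_map R h S M (lin_comb M n x) (A.pure v s) =
        lin_comb B n (\<lambda>j. pure (x j) \<one>\<^bsub>S\<^esub>) (free_base_change h S n (A.pure v s))"
      using base_change_map_pure[OF free scalar_extension_axioms f, of v s]
      by (simp only: free_base_change_pure[OF M.is_cring S.is_cring h v s]
          lin_comb_base_change[OF x PiE_funcset[OF v] s] free_module_simps(1))
  qed (use X in simp)
qed

section \<open>The theorem\<close>

theorem theorem2:
  fixes R1 :: "'a ring" and R2 :: "'b ring" and R12 :: "'c ring"
    and h1 :: "'a \<Rightarrow> 'c" and h2 :: "'b \<Rightarrow> 'c"
    and M1 :: "('a,'m) module" and M2 :: "('b,'n) module"
    and \<phi> :: "('m,'c) tensor \<Rightarrow> ('n,'c) tensor"
  assumes "cring R1" and "cring R2" and "cring R12"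
    and "h1 \<in> ring_hom R1 R12" and "h2 \<in> ring_hom R2 R12"
    and "flat_module R1 (ring_as_module R12 h1)" and "flat_module R2 (ring_as_module R12 h2)"
    and "bij_betw (tensor_mult R12)
           (carrier (tensor_module R2 (ring_as_module R12 h2) (ring_as_module R12 h2)))
           (carrier R12)"
    and "fiber_obj R1 h1 R2 h2 R12 (M1, M2, \<phi>)"
    and "fin_gen_module R1 M1" and "fin_gen_module R2 M2"
  shows "\<exists>n. \<exists>A \<in> GL n R12.
           fiber_quotient R1 h1 R2 h2 R12 (M1, M2, \<phi>) (free_triple R1 h1 R2 h2 R12 n A)"
proof -
  interpret R1: cring R1 by fact
  interpret R2: cring R2 by fact
  interpret R12: cring R12 by fact
  have M: "module R1 M1" "module R2 M2"
    and \<phi>: "\<phi> \<in> mod_isos R12 (base_change R1 h1 R12 M1) (base_change R2 h2 R12 M2)"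
    using assms(9) by (auto simp: fiber_obj_def)
  interpret E1: scalar_extension R1 R12 h1 M1
    by (intro scalar_extension.intro scalar_extension_axioms.intro M assms(3,4))
  interpret E2: scalar_extension R2 R12 h2 M2
    by (intro scalar_extension.intro scalar_extension_axioms.intro M assms(3,5))
  have hom_\<phi>: "\<phi> \<in> mod_homs R12 E1.B E2.B" and bij_\<phi>: "bij_betw \<phi> (carrier E1.B) (carrier E2.B)"
    using \<phi> by (auto simp: mod_isos_def)

  obtain G1 where fin1: "finite G1" and G1: "G1 \<subseteq> carrier M1"
    and gen1: "\<forall>x\<in>carrier M1. \<exists>c\<in>G1 \<rightarrow> carrier R1. x = (\<Oplus>\<^bsub>M1\<^esub>a\<in>G1. c a \<odot>\<^bsub>M1\<^esub> a)"
    using assms(10) unfolding fin_gen_module_def by blast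
  obtain G2 where fin2: "finite G2" and G2: "G2 \<subseteq> carrier M2"
    and gen2: "\<forall>x\<in>carrier M2. \<exists>c\<in>G2 \<rightarrow> carrier R2. x = (\<Oplus>\<^bsub>M2\<^esub>a\<in>G2. c a \<odot>\<^bsub>M2\<^esub> a)"
    using assms(11) unfolding fin_gen_module_def by blast
  \<comment> \<open>Room for both generating sets side by side; if both are empty, then n =
    0.\<close>
  define n where "n = card G1 + card G2"
  define I where "I = {..<card G1}"
  define J where "J = {card G1..<n}"
  have IJ: "I \<subseteq> {..<n}" "J \<subseteq> {..<n}" "I \<inter> J = {}" "{..<n} = I \<union> J"
    by (auto simp: I_def J_def n_def)
  obtain g1 where g1: "bij_betw g1 I G1"
    using finite_same_card_bij[of I G1] fin1 by (auto simp: I_def)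
  obtain g2 where g2: "bij_betw g2 J G2"
    using finite_same_card_bij[of J G2] fin2 by (auto simp: J_def n_def)
  define x where "x = (\<lambda>i. if i \<in> I then g1 i else \<zero>\<^bsub>M1\<^esub>)"
  define y where "y = (\<lambda>i. if i \<in> J then g2 i else \<zero>\<^bsub>M2\<^esub>)"
  have x: "x \<in> {..<n} \<rightarrow> carrier M1" and y: "y \<in> {..<n} \<rightarrow> carrier M2"
    using g1 g2 G1 G2 by (auto simp: x_def y_def bij_betw_def image_subset_iff)
  have span_x: "carrier M1 \<subseteq> lin_comb M1 n x ` ({..<n} \<rightarrow>\<^sub>E carrier R1)"
    unfolding x_def by (rule E1.M.lin_comb_span[OF G1 gen1 g1 IJ(1)])
  have span_y: "carrier M2 \<subseteq> lin_comb M2 n y ` ({..<n} \<rightarrow>\<^sub>E carrier R2)"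
    unfolding y_def by (rule E2.M.lin_comb_span[OF G2 gen2 g2 IJ(2)])

  define u where "u = (\<lambda>j. E1.pure (x j) \<one>\<^bsub>R12\<^esub>)"
  define v where "v = (\<lambda>j. E2.pure (y j) \<one>\<^bsub>R12\<^esub>)"
  have u: "u \<in> {..<n} \<rightarrow> carrier E1.B" and v: "v \<in> {..<n} \<rightarrow> carrier E2.B"
    using x y by (auto simp: u_def v_def)
  have u': "(\<lambda>j. \<phi> (u j)) \<in> {..<n} \<rightarrow> carrier E2.B"
    using u mod_homs_closed[OF hom_\<phi>] by blast
  have \<phi>_lin_comb: "\<phi> (lin_comb E1.B n u w) = lin_comb E2.B n (\<lambda>j. \<phi> (u j)) w"
    if "w \<in> {..<n} \<rightarrow> carrier R12" for w
    by (rule lin_comb_map[OF E1.module_base_change E2.module_base_change hom_\<phi> u that])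
  obtain A where A: "A \<in> GL n R12" and Auv: "\<And>w. w \<in> {..<n} \<rightarrow> carrier R12 \<Longrightarrow>
      lin_comb E2.B n v (mat_vec R12 n A w) = lin_comb E2.B n (\<lambda>j. \<phi> (u j)) w"
  \<comment> \<open>The first family is padded on J and the second one off J, so J serves as the set
    P.\<close>
  proof (rule E2.B.lin_comb_GL[OF u' v, of J])
    fix i assume i: "i < n"
    \<comment> \<open>Padding survives the base change: 0 \<otimes> 1 = 0 by additivity in the first
      factor, and \<phi> maps zero to zero.\<close>
    have "additive M1 E1.T (\<lambda>m. E1.pure m \<one>\<^bsub>R12\<^esub>)"
      by (intro additiveI) (simp_all add: E1.pure_add_left)
    from additive_zero[OF E1.M.abelian_group_axioms E1.T.abelian_group_axioms this]
      additive_zero[OF E1.B.abelian_group_axioms E2.B.abelian_group_axioms mod_homs_additive[OF hom_\<phi>]]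
    show "\<phi> (u i) = \<zero>\<^bsub>E2.B\<^esub>" if "i \<in> J"
      using that IJ(3) by (auto simp: u_def x_def)
    have "additive M2 E2.T (\<lambda>m. E2.pure m \<one>\<^bsub>R12\<^esub>)"
      by (intro additiveI) (simp_all add: E2.pure_add_left)
    from additive_zero[OF E2.M.abelian_group_axioms E2.T.abelian_group_axioms this]
    show "v i = \<zero>\<^bsub>E2.B\<^esub>" if "i \<notin> J"
      using that by (simp add: v_def y_def)
  next
    show "carrier E2.B \<subseteq> lin_comb E2.B n (\<lambda>j. \<phi> (u j)) ` ({..<n} \<rightarrow>\<^sub>E carrier R12)"
    proof
      \<comment> \<open>Surjectivity of \<phi> carries generators of the first base change to
        generators of the second.\<close>
      fix Y assume "Y \<in> carrier E2.B"
      then obtain X where X: "X \<in> carrier E1.B" "Y = \<phi> X"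
        using bij_\<phi> by (auto simp: bij_betw_def)
      then obtain w where w: "w \<in> {..<n} \<rightarrow>\<^sub>E carrier R12" "X = lin_comb E1.B n u w"
        using E1.base_change_span[OF x span_x] unfolding u_def by blast
      show "Y \<in> lin_comb E2.B n (\<lambda>j. \<phi> (u j)) ` ({..<n} \<rightarrow>\<^sub>E carrier R12)"
        unfolding X(2) w(2) \<phi>_lin_comb[OF PiE_funcset[OF w(1)]] using w(1) by (rule imageI)
    qed
    show "carrier E2.B \<subseteq> lin_comb E2.B n v ` ({..<n} \<rightarrow>\<^sub>E carrier R12)"
      unfolding v_def by (rule E2.base_change_span[OF y span_y])
  qed (rule that)

  let ?B1 = "base_change R1 h1 R12 (free_module R1 n)" and ?B2 = "base_change R2 h2 R12 (free_module R2 n)"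
  let ?b1 = "free_base_change h1 R12 n" and ?b2 = "free_base_change h2 R12 n"
  \<comment> \<open>Written exactly as in \<open>free_triple\<close>, so that unfolding the triple
    produces this term.\<close>
  let ?\<psi> = "\<lambda>X. inv_into (carrier ?B2) ?b2 (mat_vec R12 n A (?b1 X))"
  note b1 = free_base_change_iso[OF assms(1,3,4), of n] and b2 = free_base_change_iso[OF assms(2,3,5), of n]
  note iso_A = R12.mat_vec_GL_iso[OF A]
  have B2: "module R12 ?B2"
    by (rule scalar_extension.module_base_change[OF scalar_extension_free[OF assms(2,3,5)]])
  have \<psi>: "?\<psi> \<in> mod_isos R12 ?B1 ?B2"
    by (rule mod_isos_comp[OF mod_isos_comp[OF b1 iso_A] mod_isos_inv[OF B2 b2]])
  then have hom_\<psi>: "?\<psi> \<in> mod_homs R12 ?B1 ?B2"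
    by (simp add: mod_isos_def)
  let ?f1 = "lin_comb M1 n x" and ?f2 = "lin_comb M2 n y"
  have f1: "?f1 \<in> mod_homs R1 (free_module R1 n) M1" and f2: "?f2 \<in> mod_homs R2 (free_module R2 n) M2"
    by (rule E1.M.lin_comb_hom[OF x], rule E2.M.lin_comb_hom[OF y])
  have comm: "\<phi> (base_change_map R1 h1 R12 M1 ?f1 X) = base_change_map R2 h2 R12 M2 ?f2 (?\<psi> X)"
    if X: "X \<in> carrier ?B1" for X
  proof -
    have "?b1 X \<in> carrier (free_module R12 n)"
      using b1 X by (auto simp: mod_isos_def mod_homs_def)
    then have w: "?b1 X \<in> {..<n} \<rightarrow> carrier R12" and "mat_vec R12 n A (?b1 X) \<in> carrier (free_module R12 n)"
      using iso_A by (auto simp: mod_isos_def mod_homs_def)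
    \<comment> \<open>The inverse may be cancelled because A maps coordinate vectors to coordinate
      vectors, all of which lie in the range of \<open>?b2\<close>.\<close>
    then have "?b2 (?\<psi> X) = mat_vec R12 n A (?b1 X)"
      using b2 by (intro f_inv_into_f) (auto simp: mod_isos_def bij_betw_def)
    moreover have "?\<psi> X \<in> carrier ?B2"
      by (rule mod_homs_closed[OF hom_\<psi> X])
    ultimately have "base_change_map R2 h2 R12 M2 ?f2 (?\<psi> X) = lin_comb E2.B n v (mat_vec R12 n A (?b1 X))"
      unfolding v_def by (simp add: E2.base_change_map_lin_comb[OF y])
    \<comment> \<open>The matrix equation x = y A is used here, with the coordinates of X as the
      vector w.\<close>
    also have "\<dots> = \<phi> (lin_comb E1.B n u (?b1 X))"
      by (simp add: Auv[OF w] \<phi>_lin_comb[OF w])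
    also have "\<dots> = \<phi> (base_change_map R1 h1 R12 M1 ?f1 X)"
      unfolding u_def by (simp add: E1.base_change_map_lin_comb[OF x X])
    finally show ?thesis by simp
  qed
  have surj: "?f1 ` carrier (free_module R1 n) = carrier M1" "?f2 ` carrier (free_module R2 n) = carrier M2"
    using span_x span_y mod_homs_closed[OF f1] mod_homs_closed[OF f2] by auto
  have "(?f1, ?f2) \<in> fiber_homs R1 h1 R2 h2 R12 (free_triple R1 h1 R2 h2 R12 n A) (M1, M2, \<phi>)"
    using f1 f2 comm by (simp add: fiber_homs_def free_triple_def del: free_module_simps)
  moreover have "fiber_obj R1 h1 R2 h2 R12 (free_triple R1 h1 R2 h2 R12 n A)"
    using \<psi> R1.module_free_module R2.module_free_module by (simp add: fiber_obj_def free_triple_def)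
  ultimately have "fiber_quotient R1 h1 R2 h2 R12 (M1, M2, \<phi>) (free_triple R1 h1 R2 h2 R12 n A)"
    using assms(9) surj unfolding fiber_quotient_def by (auto simp: free_triple_def)
  with A show ?thesis by blast
qed

end
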